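(* Let $\mathfrak g$ be a simple complex Lie algebra, $V=V_1\otimes\cdots\otimes V_n$ a tensor product of highest weight $\mathfrak g$-modules with highest weights $\Lambda_1,\dots,\Lambda_n$, and $\lambda\in\mathbb N^r$. Fix a basis $v_1,\dots,v_d$ of the weight space $V_\lambda$. Suppose that $u_i(\mu,z)=\sum_{j=1}^d u_{i,j}v_j$, $i=1,\dots,d$, is a basis of the space of $V_\lambda$-valued solutions, in a neighbourhood of a generic point $(\mu,z)\in\mathfrak h\times\mathbb C^n$, of the system $$\kappa\frac{\partial u}{\partial z_i}=\mu^{(i)}u+\sum_{j:\,j\ne i}\frac{\Omega^{(ij)}}{z_i-z_j}u\quad(1\le i\le n),\qquad \kappa\,\partial_{\mu'}u=\sum_{i=1}^{n}z_i(\mu')^{(i)}u+\sum_{\alpha>0}\frac{\langle\alpha,\mu'\rangle}{\langle\alpha,\mu\rangle}e_{-\alpha}e_{\alpha}u\quad(\mu'\in\mathfrak h).$$ Let $\delta_\alpha=\mathrm{tr}_{V_\lambda}(e_{-\alpha}e_\alpha)$ for positive roots $\alpha$, and $\epsilon_{ij}=\mathrm{tr}_{V_\lambda}(\Omega^{(ij)})$. Then there is a constant $C=C(V_1,\dots,V_n,\lambda,\kappa)\neq0$ (independent of $\mu$ and $z$) such that $$\det(u_{i,j})=C\exp\Big(\sum_{i=1}^n\frac{z_i}{\kappa}\mathrm{tr}_{V_\lambda}(\mu^{(i)})\Big)\prod_{\alpha>0}\langle\alpha,\mu\rangle^{\delta_\alpha/\kappa}\prod_{i<j}(z_i-z_j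)^{\epsilon_{ij}/\kappa}.$$
   Context: $\mathfrak g$ has a non-degenerate invariant symmetric bilinear form $(\,,)$ and root space decomposition $\mathfrak g=\mathfrak h\oplus\bigoplus_{\alpha\in\Delta}\mathbb C e_\alpha$ with $(e_\alpha,e_{-\alpha})=1$, and simple roots $\alpha_1,\dots,\alpha_r$. $\kappa\in\mathbb C\setminus\{0\}$. $\Omega=\sum_s h_s\otimes h_s+\sum_{\alpha\in\Delta}e_\alpha\otimes e_{-\alpha}$ with $(h_s)$ an orthonormal basis of $\mathfrak h$; $\Omega^{(ij)}$ acts on the $i$th and $j$th factors of $V$, $x^{(i)}$ is $x\in\mathfrak g$ acting on the $i$th factor, and $e_{-\alpha}e_\alpha$ acts through the tensor product action $x\mapsto\sum_i x^{(i)}$. $\partial_{\mu'}$ is the derivative in $\mu$ in direction $\mu'$. For $\lambda=(m_1,\dots,m_r)\in\mathbb N^r$, $V_\lambda$ is the weight space of $V$ of weight $\sum_j\Lambda_j-\sum_i m_i\alpha_i$; it is preserved by all operators in the system. Generic means $z_i\ne z_j$ for $i\neq j$ and $\langle\alpha,\mu\rangle\neq0$ for all $\alpha\in\Delta$. The constant depends also on the choice of the bases $(v_j)$ and $(u_i)$. *)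

theory Defs
  imports "Jordan_Normal_Form.Determinant" "HOL-Analysis.Analysis"
begin

text \<open>
  Complex vector spaces are given by a scalar multiplication \<open>s :: complex \<Rightarrow> 'a \<Rightarrow> 'a\<close>
  in the sense of the library locale \<open>vector_space\<close>. The library also has an algebraic locale
  named \<open>module\<close>, hence the qualified names.
\<close>

abbreviation subspace_of :: "(complex \<Rightarrow> 'a \<Rightarrow> 'a::ab_group_add) \<Rightarrow> 'a set \<Rightarrow> bool"
  where "subspace_of s \<equiv> Modules.module.subspace s"

abbreviation span_of :: "(complex \<Rightarrow> 'a \<Rightarrow> 'a::ab_group_add) \<Rightarrow> 'a set \<Rightarrow> 'a set"
  where "span_of s \<equiv> Modules.module.span s"

abbreviation independent_of :: "(complex \<Rightarrow> 'a \<Rightarrow> 'a::ab_group_add) \<Rightarrow> 'a set \<Rightarrow> bool"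
  where "independent_of s B \<equiv> \<not> Modules.module.dependent s B"

definition basis_of ::
    "(complex \<Rightarrow> 'a \<Rightarrow> 'a::ab_group_add) \<Rightarrow> 'a set \<Rightarrow> nat \<Rightarrow> (nat \<Rightarrow> 'a) \<Rightarrow> bool"
  where "basis_of s W d v \<longleftrightarrow>
    inj_on v {..<d} \<and> independent_of s (v ` {..<d}) \<and> span_of s (v ` {..<d}) = W"

text \<open>The trace of an endomorphism \<open>f\<close> of a finite-dimensional subspace \<open>W\<close>.\<close>

definition trace_on ::
    "(complex \<Rightarrow> 'a \<Rightarrow> 'a::ab_group_add) \<Rightarrow> 'a set \<Rightarrow> ('a \<Rightarrow> 'a) \<Rightarrow> complex"
  where "trace_on s W f =
    (let B = (SOME B. independent_of s B \<and> span_of s B = W)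
     in \<Sum>b\<in>B. Modules.module.representation s B (f b) b)"


section \<open>Simple Lie algebras with a root space decomposition\<close>

locale lie_algebra = vector_space sg
  for sg :: "complex \<Rightarrow> 'g \<Rightarrow> 'g::ab_group_add" +
  fixes br :: "'g \<Rightarrow> 'g \<Rightarrow> 'g"
  assumes br_linear_right: "Vector_Spaces.linear sg sg (br x)"
    and br_linear_left: "Vector_Spaces.linear sg sg (\<lambda>x. br x y)"
    and br_alternating: "br x x = 0"
    and jacobi: "br x (br y z) + br y (br z x) + br z (br x y) = 0"

text \<open>
  The class \<open>euclidean_space\<close> says that \<open>'g\<close> is finite-dimensional and equips it with its canonical
  topology (all inner products on \<open>'g\<close> induce the same one). The inner product itself is never used.
\<close>

locale simple_lie_algebra = lie_algebra sg br
  for sg :: "complex \<Rightarrow> 'g \<Rightarrow> 'g::euclidean_space" and br +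
  assumes scale_of_real: "sg (of_real t) x = t *\<^sub>R x"
    and not_abelian: "\<exists>x y. br x y \<noteq> 0"
    and no_proper_ideal:
      "subspace_of sg I \<Longrightarrow> (\<And>x y. y \<in> I \<Longrightarrow> br x y \<in> I) \<Longrightarrow> I = {0} \<or> I = UNIV"

text \<open>
  An element of the dual of \<open>H\<close> is represented by the function on \<open>'g\<close> that extends it by \<open>0\<close>
  outside \<open>H\<close>. Distinct functions are then distinct functionals, the pairing of \<open>\<alpha>\<close> and \<open>\<mu>\<close> is
  \<open>\<alpha> \<mu>\<close>, and the pointwise operations, such as \<open>- \<alpha>\<close>, are those of the dual space.
\<close>

definition dual_of :: "(complex \<Rightarrow> 'g \<Rightarrow> 'g::ab_group_add) \<Rightarrow> 'g set \<Rightarrow> ('g \<Rightarrow> complex) set"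
  where "dual_of sg H = {\<alpha>.
    (\<forall>x\<in>H. \<forall>y\<in>H. \<alpha> (x + y) = \<alpha> x + \<alpha> y) \<and>
    (\<forall>c. \<forall>x\<in>H. \<alpha> (sg c x) = c * \<alpha> x) \<and>
    (\<forall>x. x \<notin> H \<longrightarrow> \<alpha> x = 0)}"

definition root_space ::
    "(complex \<Rightarrow> 'g \<Rightarrow> 'g::ab_group_add) \<Rightarrow> ('g \<Rightarrow> 'g \<Rightarrow> 'g) \<Rightarrow> 'g set \<Rightarrow> ('g \<Rightarrow> complex) \<Rightarrow> 'g set"
  where "root_space sg br H \<alpha> = {x. \<forall>h\<in>H. br h x = sg (\<alpha> h) x}"

definition roots ::
    "(complex \<Rightarrow> 'g \<Rightarrow> 'g::ab_group_add) \<Rightarrow> ('g \<Rightarrow> 'g \<Rightarrow> 'g) \<Rightarrow> 'g set \<Rightarrow> ('g \<Rightarrow> complex) set"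
  where "roots sg br H =
    {\<alpha> \<in> dual_of sg H. \<alpha> \<noteq> (\<lambda>_. 0) \<and> root_space sg br H \<alpha> \<noteq> {0}}"

text \<open>
  The decomposition \<open>\<gg> = H \<oplus> (\<Oplus>\<alpha>. \<complex> e \<alpha>)\<close> with respect to an abelian subalgebra \<open>H\<close>
  makes \<open>H\<close> its own centralizer, so that \<open>H\<close> is a Cartan subalgebra.
\<close>

locale root_decomposition = simple_lie_algebra sg br
  for sg :: "complex \<Rightarrow> 'g \<Rightarrow> 'g::euclidean_space" and br +
  fixes form :: "'g \<Rightarrow> 'g \<Rightarrow> complex"
    and H :: "'g set"
    and e :: "('g \<Rightarrow> complex) \<Rightarrow> 'g"
  assumes form_linear: "Vector_Spaces.linear sg (*) (form x)"
    and form_sym: "form x y = form y x"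
    and form_invariant: "form (br x y) z = form x (br y z)"
    and form_nondegenerate: "(\<And>y. form x y = 0) \<Longrightarrow> x = 0"
    and subspace_H: "subspace_of sg H"
    and abelian_H: "h \<in> H \<Longrightarrow> h' \<in> H \<Longrightarrow> br h h' = 0"
    and finite_roots: "finite (roots sg br H)"
    and e_root_space: "\<alpha> \<in> roots sg br H \<Longrightarrow> e \<alpha> \<in> root_space sg br H \<alpha>"
    and direct_sum: "\<exists>!(h, c). h \<in> H \<and> (\<forall>\<alpha>. \<alpha> \<notin> roots sg br H \<longrightarrow> c \<alpha> = 0) \<and>
          x = h + (\<Sum>\<alpha>\<in>roots sg br H. sg (c \<alpha>) (e \<alpha>))"
    and form_e: "\<alpha> \<in> roots sg br H \<Longrightarrow> form (e \<alpha>) (e (- \<alpha>)) = 1"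

text \<open>The simple roots are \<open>a 0, \<dots>, a (r - 1)\<close>.\<close>

definition positive_roots ::
    "('g \<Rightarrow> complex) set \<Rightarrow> nat \<Rightarrow> (nat \<Rightarrow> 'g \<Rightarrow> complex) \<Rightarrow> ('g \<Rightarrow> complex) set"
  where "positive_roots R r a =
    {\<alpha> \<in> R. \<exists>k :: nat \<Rightarrow> nat. \<forall>h. \<alpha> h = (\<Sum>i<r. of_nat (k i) * a i h)}"

definition simple_roots ::
    "('g \<Rightarrow> complex) set \<Rightarrow> nat \<Rightarrow> (nat \<Rightarrow> 'g \<Rightarrow> complex) \<Rightarrow> bool"
  where "simple_roots R r a \<longleftrightarrow>
    (\<forall>i<r. a i \<in> R) \<and>
    (\<forall>c :: nat \<Rightarrow> complex. (\<forall>h. (\<Sum>i<r. c i * a i h) = 0) \<longrightarrow> (\<forall>i<r. c i = 0)) \<and>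
    (\<forall>\<alpha>\<in>R. \<alpha> \<in> positive_roots R r a \<or> - \<alpha> \<in> positive_roots R r a)"

definition orthonormal_basis_of ::
    "(complex \<Rightarrow> 'g \<Rightarrow> 'g::ab_group_add) \<Rightarrow> ('g \<Rightarrow> 'g \<Rightarrow> complex) \<Rightarrow> 'g set \<Rightarrow> nat \<Rightarrow> (nat \<Rightarrow> 'g) \<Rightarrow> bool"
  where "orthonormal_basis_of sg form H r hs \<longleftrightarrow>
    basis_of sg H r hs \<and> (\<forall>s<r. \<forall>t<r. form (hs s) (hs t) = (if s = t then 1 else 0))"


section \<open>Highest weight modules and their tensor product\<close>

text \<open>
  The modules live on subspaces of one vector space \<open>'v\<close>, which lets \<open>V\<^sub>1, \<dots>, V\<^sub>n\<close> be arbitrary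
  modules: any family of spaces embeds into its direct sum. The index set \<open>{1, \<dots>, n}\<close> becomes a
  finite linearly ordered type \<open>'n\<close>.
\<close>

definition lie_module ::
    "(complex \<Rightarrow> 'g \<Rightarrow> 'g::ab_group_add) \<Rightarrow> ('g \<Rightarrow> 'g \<Rightarrow> 'g) \<Rightarrow>
     (complex \<Rightarrow> 'v \<Rightarrow> 'v::ab_group_add) \<Rightarrow> 'v set \<Rightarrow> ('g \<Rightarrow> 'v \<Rightarrow> 'v) \<Rightarrow> bool"
  where "lie_module sg br sv V \<rho> \<longleftrightarrow>
    vector_space sv \<and> subspace_of sv V \<and>
    (\<forall>x. \<forall>v\<in>V. \<rho> x v \<in> V) \<and>
    (\<forall>x. \<forall>v\<in>V. \<forall>w\<in>V. \<rho> x (v + w) = \<rho> x v + \<rho> x w) \<and>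
    (\<forall>c x. \<forall>v\<in>V. \<rho> x (sv c v) = sv c (\<rho> x v)) \<and>
    (\<forall>x y. \<forall>v\<in>V. \<rho> (x + y) v = \<rho> x v + \<rho> y v) \<and>
    (\<forall>c x. \<forall>v\<in>V. \<rho> (sg c x) v = sv c (\<rho> x v)) \<and>
    (\<forall>x y. \<forall>v\<in>V. \<rho> (br x y) v = \<rho> x (\<rho> y v) - \<rho> y (\<rho> x v))"

definition highest_weight_module ::
    "(complex \<Rightarrow> 'g \<Rightarrow> 'g::ab_group_add) \<Rightarrow> ('g \<Rightarrow> 'g \<Rightarrow> 'g) \<Rightarrow> 'g set \<Rightarrow>
     ('g \<Rightarrow> complex) set \<Rightarrow> (('g \<Rightarrow> complex) \<Rightarrow> 'g) \<Rightarrow>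
     (complex \<Rightarrow> 'v \<Rightarrow> 'v::ab_group_add) \<Rightarrow> 'v set \<Rightarrow> ('g \<Rightarrow> 'v \<Rightarrow> 'v) \<Rightarrow> ('g \<Rightarrow> complex) \<Rightarrow> bool"
  where "highest_weight_module sg br H P e sv V \<rho> \<Lambda> \<longleftrightarrow>
    lie_module sg br sv V \<rho> \<and> \<Lambda> \<in> dual_of sg H \<and>
    (\<exists>w\<in>V. w \<noteq> 0 \<and>
      (\<forall>\<alpha>\<in>P. \<rho> (e \<alpha>) w = 0) \<and>
      (\<forall>h\<in>H. \<rho> h w = sv (\<Lambda> h) w) \<and>
      (\<forall>W. W \<subseteq> V \<and> subspace_of sv W \<and> (\<forall>x. \<forall>u\<in>W. \<rho> x u \<in> W) \<and> w \<in> W \<longrightarrow> W = V))"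

definition multilinear_on ::
    "(complex \<Rightarrow> 'v \<Rightarrow> 'v::ab_group_add) \<Rightarrow> ('n \<Rightarrow> 'v set) \<Rightarrow>
     (complex \<Rightarrow> 'w \<Rightarrow> 'w::ab_group_add) \<Rightarrow> (('n \<Rightarrow> 'v) \<Rightarrow> 'w) \<Rightarrow> bool"
  where "multilinear_on sv V sw f \<longleftrightarrow>
    (\<forall>w\<in>Pi UNIV V. \<forall>i. \<forall>x\<in>V i. \<forall>y\<in>V i. f (w(i := x + y)) = f (w(i := x)) + f (w(i := y))) \<and>
    (\<forall>w\<in>Pi UNIV V. \<forall>i. \<forall>x\<in>V i. \<forall>c. f (w(i := sv c x)) = sw c (f (w(i := x))))"

text \<open>
  \<open>\<tau> w\<close> is the pure tensor of the \<open>w i\<close>. The universal property is stated for scalar-valued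
  multilinear maps, since a definition cannot quantify over the type of the target space.
  Lemma \<open>tensor_product_universal\<close> shows that this is the universal property for all targets.
\<close>

definition tensor_product ::
    "(complex \<Rightarrow> 'v \<Rightarrow> 'v::ab_group_add) \<Rightarrow> ('n \<Rightarrow> 'v set) \<Rightarrow>
     (complex \<Rightarrow> 't \<Rightarrow> 't::ab_group_add) \<Rightarrow> (('n \<Rightarrow> 'v) \<Rightarrow> 't) \<Rightarrow> bool"
  where "tensor_product sv V st \<tau> \<longleftrightarrow>
    vector_space st \<and> multilinear_on sv V st \<tau> \<and> span_of st (\<tau> ` Pi UNIV V) = UNIV \<and>
    (\<forall>f. multilinear_on sv V (*) f \<longrightarrow>
      (\<exists>F. Vector_Spaces.linear st (*) F \<and> (\<forall>w\<in>Pi UNIV V. F (\<tau> w) = f w)))"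

lemma tensor_product_universal:
  fixes sw :: "complex \<Rightarrow> 'w \<Rightarrow> 'w::ab_group_add"
  assumes tp: "tensor_product sv V st \<tau>" and sw: "vector_space sw"
    and f: "multilinear_on sv V sw f"
  shows "\<exists>F. Vector_Spaces.linear st sw F \<and> (\<forall>w\<in>Pi UNIV V. F (\<tau> w) = f w) \<and>
    (\<forall>G. Vector_Spaces.linear st sw G \<and> (\<forall>w\<in>Pi UNIV V. G (\<tau> w) = f w) \<longrightarrow> G = F)"
proof -
  interpret T: vector_space st using tp by (simp add: tensor_product_def)
  interpret W: vector_space sw by (rule sw)
  interpret P: vector_space_pair st sw by unfold_locales
  have spn: "T.span (\<tau> ` Pi UNIV V) = UNIV" using tp by (simp add: tensor_product_def)
  define B where "B = W.extend_basis {}"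
  have B: "W.independent B" "W.span B = UNIV"
    unfolding B_def by (simp_all add: W.independent_extend_basis W.independent_empty)
  let ?R = "W.representation B"
  have "\<exists>F. Vector_Spaces.linear st (*) F \<and> (\<forall>w\<in>Pi UNIV V. F (\<tau> w) = ?R (f w) b)" for b
  proof -
    have "multilinear_on sv V (*) (\<lambda>w. ?R (f w) b)"
      using f B unfolding multilinear_on_def
      by (simp add: W.representation_add W.representation_scale)
    then show ?thesis using tp by (simp add: tensor_product_def)
  qed
  then obtain F where Fl: "\<And>b. Vector_Spaces.linear st (*) (F b)"
    and Ft: "\<And>b w. w \<in> Pi UNIV V \<Longrightarrow> F b (\<tau> w) = ?R (f w) b" by metis
  have Fadd: "F b (x + y) = F b x + F b y" and Fsc: "F b (st c x) = c * F b x" and F0: "F b 0 = 0"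
    for b x y c
  proof -
    interpret L: Vector_Spaces.linear st "(*)" "F b" by (rule Fl)
    show "F b (x + y) = F b x + F b y" "F b (st c x) = c * F b x" "F b 0 = 0"
      by (simp_all add: L.add L.scale)
  qed
  have fin: "finite {b. F b x \<noteq> 0}" for x
  proof -
    have "x \<in> T.span (\<tau> ` Pi UNIV V)" using spn by simp
    then show ?thesis
    proof (induction rule: T.span_induct_alt)
      case base then show ?case by (simp add: F0)
    next
      case (step c x y)
      have "finite {b. F b x \<noteq> 0}" using step(1) Ft W.finite_representation by auto
      with step(2) have "finite ({b. F b x \<noteq> 0} \<union> {b. F b y \<noteq> 0})" by simp
      then show ?case by (rule rev_finite_subset) (auto simp: Fadd Fsc)
    qed
  qed
  define G where "G x = (\<Sum>b | F b x \<noteq> 0. sw (F b x) b)" for x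
  have Geq: "G x = (\<Sum>b\<in>A. sw (F b x) b)" if "finite A" "{b. F b x \<noteq> 0} \<subseteq> A" for A x
    unfolding G_def using that by (intro sum.mono_neutral_left) auto
  have Gl: "Vector_Spaces.linear st sw G"
    unfolding Vector_Spaces.linear_iff
  proof (intro conjI allI)
    show "G (x + y) = G x + G y" for x y
    proof -
      let ?A = "{b. F b x \<noteq> 0} \<union> {b. F b y \<noteq> 0}"
      have "finite ?A" using fin by simp
      moreover have "{b. F b (x + y) \<noteq> 0} \<subseteq> ?A" by (auto simp: Fadd)
      ultimately show ?thesis
        using Geq[of ?A x] Geq[of ?A y] Geq[of ?A "x + y"]
        by (simp add: Fadd W.scale_left_distrib sum.distrib)
    qed
    show "G (st c x) = sw c (G x)" for c x
    proof -
      have "{b. F b (st c x) \<noteq> 0} \<subseteq> {b. F b x \<noteq> 0}" by (auto simp: Fsc)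
      then have "G (st c x) = (\<Sum>b | F b x \<noteq> 0. sw (F b (st c x)) b)"
        using Geq fin by simp
      then show ?thesis by (simp add: G_def Fsc W.scale_sum_right)
    qed
  qed unfold_locales
  have Gt: "G (\<tau> w) = f w" if "w \<in> Pi UNIV V" for w
    unfolding G_def using that B by (simp add: Ft W.sum_nonzero_representation_eq)
  have "K = G" if K: "Vector_Spaces.linear st sw K" "\<forall>w\<in>Pi UNIV V. K (\<tau> w) = f w" for K
  proof
    show "K x = G x" for x
      by (rule P.linear_eq_on[OF K(1) Gl, where B = "\<tau> ` Pi UNIV V"]) (use spn K Gt in auto)
  qed
  then show ?thesis using Gl Gt by blast
qed

text \<open>\<open>act i x\<close> is \<open>x\<^bsup>(i)\<^esup>\<close>, the action of \<open>x\<close> on the \<open>i\<close>-th factor.\<close>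

definition factor_action ::
    "(complex \<Rightarrow> 't \<Rightarrow> 't::ab_group_add) \<Rightarrow> ('n \<Rightarrow> 'v set) \<Rightarrow> ('n \<Rightarrow> 'g \<Rightarrow> 'v \<Rightarrow> 'v) \<Rightarrow>
     (('n \<Rightarrow> 'v) \<Rightarrow> 't) \<Rightarrow> ('n \<Rightarrow> 'g \<Rightarrow> 't \<Rightarrow> 't) \<Rightarrow> bool"
  where "factor_action st V \<rho> \<tau> act \<longleftrightarrow>
    (\<forall>i x. Vector_Spaces.linear st st (act i x) \<and>
      (\<forall>w\<in>Pi UNIV V. act i x (\<tau> w) = \<tau> (w(i := \<rho> i x (w i)))))"

definition total_action :: "('n::finite \<Rightarrow> 'g \<Rightarrow> 't \<Rightarrow> 't::ab_group_add) \<Rightarrow> 'g \<Rightarrow> 't \<Rightarrow> 't"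
  where "total_action act x u = (\<Sum>i\<in>UNIV. act i x u)"

definition weight_space ::
    "(complex \<Rightarrow> 't \<Rightarrow> 't::ab_group_add) \<Rightarrow> 'g set \<Rightarrow> ('n::finite \<Rightarrow> 'g \<Rightarrow> 't \<Rightarrow> 't) \<Rightarrow> ('g \<Rightarrow> complex) \<Rightarrow> 't set"
  where "weight_space st H act \<nu> = {u. \<forall>h\<in>H. total_action act h u = st (\<nu> h) u}"

definition Omega ::
    "('g \<Rightarrow> complex) set \<Rightarrow> (('g \<Rightarrow> complex) \<Rightarrow> 'g) \<Rightarrow> nat \<Rightarrow> (nat \<Rightarrow> 'g) \<Rightarrow>
     ('n \<Rightarrow> 'g \<Rightarrow> 't \<Rightarrow> 't::ab_group_add) \<Rightarrow> 'n \<Rightarrow> 'n \<Rightarrow> 't \<Rightarrow> 't"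
  where "Omega R e r hs act i j u =
    (\<Sum>s<r. act i (hs s) (act j (hs s) u)) + (\<Sum>\<alpha>\<in>R. act i (e \<alpha>) (act j (e (- \<alpha>)) u))"


section \<open>The system of differential equations\<close>

definition generic_points ::
    "'g set \<Rightarrow> ('g \<Rightarrow> complex) set \<Rightarrow> ('g \<times> (complex ^ 'n)) set"
  where "generic_points H R =
    {(\<mu>, z). \<mu> \<in> H \<and> (\<forall>i j. i \<noteq> j \<longrightarrow> vec_nth z i \<noteq> vec_nth z j) \<and> (\<forall>\<alpha>\<in>R. \<alpha> \<mu> \<noteq> 0)}"

text \<open>
  Functions into a vector space without topology are differentiated by applying linear functionals.
  For values in a finite-dimensional subspace this is differentiation of all coordinates.
\<close>

definition has_vderiv ::
    "(complex \<Rightarrow> 't \<Rightarrow> 't::ab_group_add) \<Rightarrow> (complex \<Rightarrow> 't) \<Rightarrow> 't \<Rightarrow> complex \<Rightarrow> bool"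
  where "has_vderiv st f f' t \<longleftrightarrow>
    (\<forall>\<phi>. Vector_Spaces.linear st (*) \<phi> \<longrightarrow> ((\<lambda>s. \<phi> (f s)) has_field_derivative \<phi> f') (at t))"

definition vdifferentiable_on ::
    "(complex \<Rightarrow> 't \<Rightarrow> 't::ab_group_add) \<Rightarrow> ('p::real_normed_vector \<Rightarrow> 't) \<Rightarrow> 'p set \<Rightarrow> bool"
  where "vdifferentiable_on st f U \<longleftrightarrow>
    (\<forall>\<phi>. Vector_Spaces.linear st (*) \<phi> \<longrightarrow> (\<lambda>p. \<phi> (f p)) differentiable_on U)"

text \<open>
  The partial derivatives are derivatives at \<open>0\<close> along complex lines, and the equations determine
  them, so a solution is a function that is (real) differentiable with complex linear derivative,
  that is, a holomorphic function.
\<close>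

definition is_solution ::
    "(complex \<Rightarrow> 'g \<Rightarrow> 'g::euclidean_space) \<Rightarrow> 'g set \<Rightarrow>
     ('g \<Rightarrow> complex) set \<Rightarrow> ('g \<Rightarrow> complex) set \<Rightarrow> (('g \<Rightarrow> complex) \<Rightarrow> 'g) \<Rightarrow> nat \<Rightarrow> (nat \<Rightarrow> 'g) \<Rightarrow>
     (complex \<Rightarrow> 't \<Rightarrow> 't::ab_group_add) \<Rightarrow> ('n::finite \<Rightarrow> 'g \<Rightarrow> 't \<Rightarrow> 't) \<Rightarrow> complex \<Rightarrow> 't set \<Rightarrow>
     ('g \<times> (complex ^ 'n)) set \<Rightarrow> ('g \<times> (complex ^ 'n) \<Rightarrow> 't) \<Rightarrow> bool"
  where "is_solution sg H R P e r hs st act \<kappa> W U u \<longleftrightarrow>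
    vdifferentiable_on st u U \<and>
    (\<forall>(\<mu>, z)\<in>U. u (\<mu>, z) \<in> W \<and>
      (\<forall>i. \<exists>D. has_vderiv st (\<lambda>t. u (\<mu>, z + axis i t)) D 0 \<and>
        st \<kappa> D = act i \<mu> (u (\<mu>, z)) +
          (\<Sum>j\<in>UNIV - {i}. st (1 / (vec_nth z i - vec_nth z j)) (Omega R e r hs act i j (u (\<mu>, z))))) \<and>
      (\<forall>\<mu>'\<in>H. \<exists>D. has_vderiv st (\<lambda>t. u (\<mu> + sg t \<mu>', z)) D 0 \<and>
        st \<kappa> D = (\<Sum>i\<in>UNIV. st (vec_nth z i) (act i \<mu>' (u (\<mu>, z)))) +
          (\<Sum>\<alpha>\<in>P. st (\<alpha> \<mu>' / \<alpha> \<mu>)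
            (total_action act (e (- \<alpha>)) (total_action act (e \<alpha>) (u (\<mu>, z)))))))"

text \<open>\<open>u 0, \<dots>, u (d - 1)\<close> form a basis of the vector space of functions on \<open>U\<close> satisfying \<open>sol\<close>.\<close>

definition basis_of_solutions ::
    "(complex \<Rightarrow> 't \<Rightarrow> 't::ab_group_add) \<Rightarrow> 'p set \<Rightarrow> (('p \<Rightarrow> 't) \<Rightarrow> bool) \<Rightarrow> nat \<Rightarrow> (nat \<Rightarrow> 'p \<Rightarrow> 't) \<Rightarrow> bool"
  where "basis_of_solutions st U sol d u \<longleftrightarrow>
    (\<forall>i<d. sol (u i)) \<and>
    (\<forall>c. (\<forall>p\<in>U. (\<Sum>i<d. st (c i) (u i p)) = 0) \<longrightarrow> (\<forall>i<d. c i = 0)) \<and>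
    (\<forall>w. sol w \<longrightarrow> (\<exists>c. \<forall>p\<in>U. w p = (\<Sum>i<d. st (c i) (u i p))))"

text \<open>
  For a branch \<open>L\<close> of the logarithm of \<open>f\<close>, the power of \<open>f\<close> with exponent \<open>s\<close> is \<open>exp (s * L)\<close>.
\<close>

definition log_branch_on ::
    "'p::topological_space set \<Rightarrow> ('p \<Rightarrow> complex) \<Rightarrow> ('p \<Rightarrow> complex) \<Rightarrow> bool"
  where "log_branch_on U f L \<longleftrightarrow> continuous_on U L \<and> (\<forall>p\<in>U. exp (L p) = f p)"

end

theory Submission
  imports Defs
begin

text \<open>
  In the coordinates of the basis of \<open>V\<^sub>\<lambda>\<close> the system is a linear Pfaffian system
  \<open>du = A u\<close>, so by Liouville's formula the Wronskian determinant satisfies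
  \<open>d (det u) = tr A \<cdot> det u\<close>. All the operators preserve the weight space, hence the
  coefficients of \<open>tr A\<close> are the given traces, and by the symmetry of \<open>\<Omega>\<close> in its two indices
  \<open>tr A\<close> is the differential of the logarithm of the claimed product. The quotient of the two sides
  is thus locally constant. If it were zero, some nontrivial combination of the solutions would
  vanish at a point, and then everywhere on the connected domain by uniqueness for linear
  differential equations along segments.
\<close>

section \<open>Linear Pfaffian systems\<close>

text \<open>The points range over \<open>H \<times> UNIV\<close>, a proper real subspace of the
  ambient normed space, and \<open>U\<close> is open only relative to it. A derivative within
  \<open>U\<close> is therefore determined only on directions in that subspace, and the statements
  about derivatives below prescribe their values there and nowhere else. Three objects have to be
  fitted to this setting. Roots are extended by 0 outside \<open>H\<close>, so they are not linear
  on the whole algebra and are replaced by a linear expression in the invariant form. Branches of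
  the logarithm are only continuous by definition, so their derivatives must be established. Values
  lie in a space without topology and are read through linear functionals on it. Finally, solutions
  are differentiable in the real sense while the equations speak of complex derivatives along lines;
  testing the real derivative on complex curves links the two.\<close>

lemma det_mat_replace_col:
  fixes M :: "nat \<Rightarrow> nat \<Rightarrow> 'a::idom"
  assumes "j < d" "k < d"
  shows "Determinant.det (Matrix.mat d d (\<lambda>(a, b). M a (if b = j then k else b))) =
    (if k = j then Determinant.det (Matrix.mat d d (\<lambda>(a, b). M a b)) else 0)"
proof (cases "k = j")
  case True
  then have "(\<lambda>(a, b). M a (if b = j then k else b)) = (\<lambda>(a, b). M a b)"
    by (auto simp: fun_eq_iff)
  with True show ?thesis by simp
next
  case False
  have "Determinant.det (Matrix.mat d d (\<lambda>(a, b). M a (if b = j then k else b))) = 0"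
    by (rule Determinant.det_identical_columns[where i = j and j = k and n = d])
      (use assms False in \<open>auto intro!: Matrix.eq_vecI\<close>)
  with False show ?thesis by simp
qed

text \<open>Jacobi's formula in a form that needs no invertible matrix: each differentiated column
  \<open>j\<close> is a combination of the columns \<open>k\<close> with coefficients
  \<open>B k j\<close>, and only the terms with \<open>k = j\<close> avoid a repeated column. One
  \<open>D\<close> serves all \<open>h\<close> and \<open>B\<close>, so it can be evaluated just in
  those directions where such a \<open>B\<close> is known.\<close>

lemma has_derivative_det:
  fixes Y :: "nat \<Rightarrow> nat \<Rightarrow> 'p::real_normed_vector \<Rightarrow> 'a::real_normed_field"
  assumes "\<And>i j. i < d \<Longrightarrow> j < d \<Longrightarrow> (Y i j has_derivative Y' i j) (at p within U)"
  shows "\<exists>D. ((\<lambda>q. Determinant.det (Matrix.mat d d (\<lambda>(i, j). Y i j q))) has_derivative D) (at p within U) \<and>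
    (\<forall>h B. (\<forall>i<d. \<forall>j<d. Y' i j h = (\<Sum>k<d. Y i k p * B k j)) \<longrightarrow>
      D h = (\<Sum>k<d. B k k) * Determinant.det (Matrix.mat d d (\<lambda>(i, j). Y i j p)))"
proof -
  let ?S = "{s. s permutes {0..<d}}"
  have bnd: "s j < d" if "s \<in> ?S" "j < d" for s j
    using that permutes_in_image[of s "{0..<d}" j] by simp
  have det_eq: "Determinant.det (Matrix.mat d d (\<lambda>(i, j). M i j)) =
      (\<Sum>s\<in>?S. signof s * (\<Prod>j<d. M (s j) j))" for M :: "nat \<Rightarrow> nat \<Rightarrow> 'a"
    by (subst Determinant.det_col[where n = d]) (auto intro!: sum.cong prod.cong simp: bnd)
  \<comment> \<open>The product rule applied to each term of the Leibniz expansion.\<close>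
  define D where "D h = (\<Sum>s\<in>?S. signof s *
      (\<Sum>j<d. Y' (s j) j h * (\<Prod>b\<in>{..<d} - {j}. Y (s b) b p)))" for h
  have "((\<lambda>q. \<Sum>s\<in>?S. signof s * (\<Prod>j<d. Y (s j) j q)) has_derivative D) (at p within U)"
    unfolding D_def
    by (intro has_derivative_sum has_derivative_mult_right has_derivative_prod)
      (use assms bnd in auto)
  moreover have "D h = (\<Sum>k<d. B k k) * Determinant.det (Matrix.mat d d (\<lambda>(i, j). Y i j p))"
    if B: "\<forall>i<d. \<forall>j<d. Y' i j h = (\<Sum>k<d. Y i k p * B k j)" for h B
  proof -
    have "D h = (\<Sum>s\<in>?S. \<Sum>j<d. \<Sum>k<d. B k j *
        (signof s * (Y (s j) k p * (\<Prod>b\<in>{..<d} - {j}. Y (s b) b p))))"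
      unfolding D_def using B bnd
      by (intro sum.cong refl) (simp add: sum_distrib_left sum_distrib_right mult_ac)
    also have "\<dots> = (\<Sum>s\<in>?S. \<Sum>j<d. \<Sum>k<d. B k j *
        (signof s * (\<Prod>b<d. Y (s b) (if b = j then k else b) p)))"
    \<comment> \<open>Absorbing the factor at \<open>j\<close> into the product makes the sum over
      permutations a determinant again, namely that of the matrix whose column \<open>j\<close> is
      overwritten by column \<open>k\<close>.\<close>
    proof (intro sum.cong refl)
      fix s j k assume "j \<in> {..<d}"
      then have "(\<Prod>b<d. Y (s b) (if b = j then k else b) p) =
          Y (s j) k p * (\<Prod>b\<in>{..<d} - {j}. Y (s b) b p)"
        by (subst prod.remove[of _ j]) (auto intro!: prod.cong)
      then show "B k j * (signof s * (Y (s j) k p * (\<Prod>b\<in>{..<d} - {j}. Y (s b) b p))) =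
          B k j * (signof s * (\<Prod>b<d. Y (s b) (if b = j then k else b) p))" by simp
    qed
    also have "\<dots> = (\<Sum>j<d. \<Sum>k<d. B k j *
        Determinant.det (Matrix.mat d d (\<lambda>(i, b). Y i (if b = j then k else b) p)))"
      unfolding det_eq sum_distrib_left
      by (subst sum.swap) (intro sum.cong refl, subst sum.swap, rule refl)
    also have "\<dots> = (\<Sum>j<d. \<Sum>k<d. if k = j then B j j *
        Determinant.det (Matrix.mat d d (\<lambda>(i, j). Y i j p)) else 0)"
      by (intro sum.cong refl)
        (subst det_mat_replace_col[where M = "\<lambda>i j. Y i j p"], auto)
    finally show ?thesis by (simp add: sum_distrib_right)
  qed
  ultimately show ?thesis unfolding det_eq by blast
qed

section \<open>Local arguments on relatively open subsets of a subspace\<close>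

text \<open>A small ball cut with \<open>E\<close> is convex and lies in \<open>U\<close>. Arguments
  along segments take place in such a piece, since \<open>U\<close> itself is only
  connected.\<close>

lemma openin_subspace_convex_nhd:
  fixes E :: "'p::real_normed_vector set"
  assumes "subspace E" "openin (top_of_set E) U" "p \<in> U"
  obtains T where "convex T" "openin (top_of_set U) T" "p \<in> T" "T \<subseteq> U"
proof -
  obtain \<epsilon> where "0 < \<epsilon>" and \<epsilon>: "ball p \<epsilon> \<inter> E \<subseteq> U"
    using assms(2,3) by (force simp: openin_contains_ball)
  have UE: "U \<subseteq> E" using assms(2) by (simp add: openin_imp_subset)
  show thesis
  proof
    show "convex (ball p \<epsilon> \<inter> E)"
      using assms(1) by (simp add: convex_Int subspace_imp_convex)
    have "ball p \<epsilon> \<inter> E = U \<inter> ball p \<epsilon>" using \<epsilon> UE by auto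
    then show "openin (top_of_set U) (ball p \<epsilon> \<inter> E)" by auto
    show "p \<in> ball p \<epsilon> \<inter> E" using assms(3) UE \<open>0 < \<epsilon>\<close> by auto
  qed (rule \<epsilon>)
qed

text \<open>The derivative \<open>f'\<close> may be nonzero off \<open>E\<close>. Inside a convex
  piece of \<open>U\<close> all increments lie in \<open>E\<close>, so there \<open>f'\<close> can
  be traded for the zero map, and the usual theorem on convex sets applies.\<close>

lemma zero_derivative_along_subspace_constant:
  fixes f :: "'p::real_normed_vector \<Rightarrow> 'b::real_normed_vector"
  assumes E: "subspace E" "openin (top_of_set E) U" and "connected U"
    and f: "\<And>p. p \<in> U \<Longrightarrow> \<exists>f'. (f has_derivative f') (at p within U) \<and> (\<forall>h\<in>E. f' h = 0)"
  shows "f constant_on U"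
proof (rule locally_constant_imp_constant[OF \<open>connected U\<close>])
  fix p assume "p \<in> U"
  obtain T where T: "convex T" "openin (top_of_set U) T" "p \<in> T" "T \<subseteq> U"
    by (rule openin_subspace_convex_nhd[OF E \<open>p \<in> U\<close>])
  have UE: "U \<subseteq> E" using E(2) by (simp add: openin_imp_subset)
  have "(f has_derivative (\<lambda>_. 0)) (at q within T)" if q: "q \<in> T" for q
  proof -
    obtain f' where f': "(f has_derivative f') (at q within U)" "\<forall>h\<in>E. f' h = 0"
      using f q T(4) by blast
    have "x - q \<in> E" if "x \<in> T" for x
      using that q T(4) UE subspace_diff[OF E(1)] by blast
    then have z: "f' (x - q) = 0" if "x \<in> T" for x using f'(2) that by blast
    have "(f has_derivative f') (at q within T)"
      by (rule has_derivative_subset[OF f'(1) T(4)])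
    then have lim: "((\<lambda>x. norm (f x - f q - f' (x - q)) / norm (x - q)) \<longlongrightarrow> 0) (at q within T)"
      by (simp add: has_derivative_iff_norm)
    \<comment> \<open>For \<open>x\<close> in \<open>T\<close> the difference quotients with
      \<open>f'\<close> and with 0 coincide.\<close>
    have "((\<lambda>x. norm (f x - f q - 0) / norm (x - q)) \<longlongrightarrow> 0) (at q within T)"
      by (rule Lim_transform_eventually[OF lim]) (simp add: eventually_at_filter z)
    then show ?thesis by (simp add: has_derivative_iff_norm)
  qed
  then have "\<forall>x\<in>T. f x = f p"
    using has_derivative_zero_unique[OF T(1)] T(3) by blast
  with T show "\<exists>T. openin (top_of_set U) T \<and> p \<in> T \<and> (\<forall>x\<in>T. f x = f p)" by blast
qed

text \<open>Gronwall's argument for the squared norm \<open>N\<close> of the solution: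
  \<open>N' \<le> c * N\<close> makes \<open>N t * exp (- c * t)\<close> nonincreasing, and it
  starts at 0.\<close>

lemma linear_ode_zero:
  fixes y :: "nat \<Rightarrow> real \<Rightarrow> complex"
  assumes y: "\<And>j t. j < d \<Longrightarrow> t \<in> {0..1} \<Longrightarrow>
      (y j has_vector_derivative (\<Sum>k<d. y k t * A t k j)) (at t within {0..1})"
    and A: "\<And>k j. k < d \<Longrightarrow> j < d \<Longrightarrow> continuous_on {0..1} (\<lambda>t. A t k j)"
    and 0: "\<And>j. j < d \<Longrightarrow> y j 0 = 0"
    and "j < d" "t \<in> {0..1}"
  shows "y j t = 0"
proof -
  have "\<exists>K. \<forall>t\<in>{0..1}. norm (A t k j) \<le> K" if "k < d" "j < d" for k j
    using compact_imp_bounded[OF compact_continuous_image[OF A[OF that] compact_Icc]]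
    by (auto simp: bounded_iff)
  note bound = this
  define K where "K k j = (SOME K. \<forall>t\<in>{0..1}. norm (A t k j) \<le> K)" for k j
  have K: "norm (A t k j) \<le> K k j" if "k < d" "j < d" "t \<in> {0..1}" for k j t
    using someI_ex[OF bound[OF that(1,2)]] that(3) unfolding K_def by blast
  \<comment> \<open>The bounds \<open>K k j\<close> are nonnegative, so their sum is a single bound
    for all entries.\<close>
  define M where "M = (\<Sum>k<d. \<Sum>j<d. K k j)"
  have K0: "0 \<le> K k j" if "k < d" "j < d" for k j
    by (rule order_trans[OF norm_ge_zero K[OF that, of 0]]) simp
  have KM: "K k j \<le> M" if "k < d" "j < d" for k j
  proof -
    have "K k j \<le> (\<Sum>j<d. K k j)" by (rule member_le_sum) (use that K0 in auto)
    also have "\<dots> \<le> M" unfolding M_def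
      by (rule member_le_sum[where f = "\<lambda>k. \<Sum>j<d. K k j"]) (use that K0 in \<open>auto intro: sum_nonneg\<close>)
    finally show ?thesis .
  qed
  define N where "N t = (\<Sum>j<d. y j t \<bullet> y j t)" for t
  define y' where "y' j t = (\<Sum>k<d. y k t * A t k j)" for j t
  define N' where "N' t = (\<Sum>j<d. 2 * (y j t \<bullet> y' j t))" for t
  have N0: "0 \<le> N t" for t unfolding N_def by (simp add: sum_nonneg)
  have N: "(N has_vector_derivative N' t) (at t within {0..1})" if "t \<in> {0..1}" for t
  proof -
    have "((\<lambda>t. y j t \<bullet> y j t) has_derivative (\<lambda>h. y j t \<bullet> (h *\<^sub>R y' j t) + (h *\<^sub>R y' j t) \<bullet> y j t))
        (at t within {0..1})" if "j < d" for j
      using y[OF that \<open>t \<in> {0..1}\<close>] unfolding has_vector_derivative_def y'_def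
      by (intro has_derivative_inner) auto
    then have "(N has_derivative (\<lambda>h. \<Sum>j<d. y j t \<bullet> (h *\<^sub>R y' j t) + (h *\<^sub>R y' j t) \<bullet> y j t))
        (at t within {0..1})"
      unfolding N_def by (intro has_derivative_sum) simp
    moreover have "(\<Sum>j<d. y j t \<bullet> (h *\<^sub>R y' j t) + (h *\<^sub>R y' j t) \<bullet> y j t) = h *\<^sub>R N' t" for h
      unfolding N'_def real_scaleR_def sum_distrib_left
      by (intro sum.cong refl) (simp add: inner_commute)
    ultimately show ?thesis by (simp add: has_vector_derivative_def)
  qed
  \<comment> \<open>By 2ab \<le> a^2 + b^2 the pair (j, k) contributes at most M times the sum of
    the squared norms of \<open>y j\<close> and \<open>y k\<close>; over all pairs each squared norm
    is counted 2d times.\<close>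
  define c where "c = 2 * real d * M"
  have N'_le: "N' t \<le> c * N t" if t: "t \<in> {0..1}" for t
  proof -
    have "2 * (y j t \<bullet> (y k t * A t k j)) \<le> M * (y j t \<bullet> y j t + y k t \<bullet> y k t)"
      if "k < d" "j < d" for k j
    proof -
      have "y j t \<bullet> (y k t * A t k j) \<le> norm (y j t) * (norm (y k t) * norm (A t k j))"
        using norm_cauchy_schwarz[of "y j t" "y k t * A t k j"] by (simp add: norm_mult)
      also have "\<dots> \<le> norm (y j t) * (norm (y k t) * M)"
        using order_trans[OF K[OF that t] KM[OF that]] by (intro mult_left_mono) auto
      finally have "2 * (y j t \<bullet> (y k t * A t k j)) \<le> M * (2 * norm (y j t) * norm (y k t))"
        by (simp add: mult_ac)
      also have "\<dots> \<le> M * ((norm (y j t))\<^sup>2 + (norm (y k t))\<^sup>2)"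
        using order_trans[OF K0[OF that] KM[OF that]]
        by (intro mult_left_mono sum_squares_bound) auto
      finally show ?thesis by (simp add: power2_norm_eq_inner)
    qed
    then have "N' t \<le> (\<Sum>j<d. \<Sum>k<d. M * (y j t \<bullet> y j t + y k t \<bullet> y k t))"
      unfolding N'_def y'_def inner_sum_right sum_distrib_left by (intro sum_mono) simp
    also have "\<dots> = c * N t"
      by (simp add: distrib_left sum.distrib sum_distrib_left[symmetric] N_def c_def)
    finally show ?thesis .
  qed
  have "N t * exp (- c * t) \<le> N 0 * exp (- c * 0)"
  \<comment> \<open>At the end points of {0..1} only a one-sided derivative of \<open>N\<close> is
    available, so monotonicity is drawn from continuity and the derivative at interior
    points.\<close>
  proof (rule DERIV_nonpos_imp_decreasing_open[of 0 t "\<lambda>t. N t * exp (- c * t)"])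
    show "0 \<le> t" using \<open>t \<in> {0..1}\<close> by simp
    show "continuous_on {0..t} (\<lambda>t. N t * exp (- c * t))"
    proof -
      have "continuous_on {0..1} N"
        unfolding continuous_on_eq_continuous_within
        by (blast intro: has_vector_derivative_continuous N)
      then have "continuous_on {0..t} N" by (rule continuous_on_subset) (use \<open>t \<in> {0..1}\<close> in auto)
      then show ?thesis by (intro continuous_intros)
    qed
    fix x assume x: "0 < x" "x < t"
    then have x1: "x \<in> {0..1}" "x \<in> interior {0..1}" using \<open>t \<in> {0..1}\<close> by auto
    have "(N has_field_derivative N' x) (at x)"
      using N[OF x1(1)] unfolding at_within_interior[OF x1(2)]
      by (rule has_real_derivative_iff_has_vector_derivative[THEN iffD2])
    then have "((\<lambda>t. N t * exp (- c * t)) has_field_derivative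
        (N' x - c * N x) * exp (- c * x)) (at x)"
    proof (rule DERIV_cong[OF DERIV_mult])
      show "((\<lambda>t. exp (- c * t)) has_field_derivative exp (- c * x) * (- c)) (at x)"
        by (rule DERIV_fun_exp, rule DERIV_cmult_Id)
    qed (simp add: algebra_simps)
    moreover have "(N' x - c * N x) * exp (- c * x) \<le> 0"
      using N'_le[OF x1(1)] by (simp add: mult_nonpos_nonneg)
    ultimately show "\<exists>y. ((\<lambda>t. N t * exp (- c * t)) has_field_derivative y) (at x) \<and> y \<le> 0"
      by blast
  qed
  also have "N 0 = 0" using 0 by (simp add: N_def)
  finally have "N t \<le> 0"
    using zero_less_mult_iff[of "N t" "exp (- c * t)"] exp_gt_zero[of "- c * t"] by linarith
  then have "(\<Sum>j<d. y j t \<bullet> y j t) = 0" using N0[of t] unfolding N_def by linarith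
  then have "y j t \<bullet> y j t = 0"
    using sum_nonneg_eq_0_iff[of "{..<d}" "\<lambda>j. y j t \<bullet> y j t"] \<open>j < d\<close> by simp
  then show ?thesis by simp
qed

text \<open>Restricted to a segment, the system becomes a linear ordinary differential equation, so
  a common zero propagates along segments. The predicate of being a common zero is then locally
  constant.\<close>

lemma linear_system_zero:
  fixes y :: "nat \<Rightarrow> 'p::real_normed_vector \<Rightarrow> complex"
  assumes E: "subspace E" "openin (top_of_set E) U" and "connected U"
    and y: "\<And>p j. p \<in> U \<Longrightarrow> j < d \<Longrightarrow> \<exists>D. (y j has_derivative D) (at p within U) \<and>
        (\<forall>h\<in>E. D h = (\<Sum>k<d. y k p * A p h k j))"
    and A: "\<And>h k j. h \<in> E \<Longrightarrow> k < d \<Longrightarrow> j < d \<Longrightarrow> continuous_on U (\<lambda>p. A p h k j)"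
    and p: "p \<in> U" "\<And>j. j < d \<Longrightarrow> y j p = 0"
    and "q \<in> U" "j < d"
  shows "y j q = 0"
proof -
  have UE: "U \<subseteq> E" using E(2) by (simp add: openin_imp_subset)
  define Z where "Z p \<longleftrightarrow> (\<forall>j<d. y j p = 0)" for p
  have seg: "Z b" if T: "convex T" "T \<subseteq> U" and ab: "a \<in> T" "b \<in> T" and "Z a" for T a b
  proof -
    define l where "l t = a + t *\<^sub>R (b - a)" for t
    have l: "l t \<in> T" if "t \<in> {0..1}" for t
      using convexD_alt[OF T(1) ab, of t] that by (simp add: l_def algebra_simps)
    have h: "b - a \<in> E" using ab T(2) UE subspace_diff[OF E(1)] by blast
    have "y j (l 1) = 0" if "j < d" for j
    proof (rule linear_ode_zero[where y = "\<lambda>j t. y j (l t)" and A = "\<lambda>t. A (l t) (b - a)" and d = d])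
      show "((\<lambda>t. y j (l t)) has_vector_derivative (\<Sum>k<d. y k (l t) * A (l t) (b - a) k j))
          (at t within {0..1})" if "j < d" and t: "t \<in> {0..1}" for j t
      proof -
        obtain D where D: "(y j has_derivative D) (at (l t) within U)"
            "\<forall>h\<in>E. D h = (\<Sum>k<d. y k (l t) * A (l t) h k j)"
          using y[OF subsetD[OF T(2) l[OF t]] \<open>j < d\<close>] by blast
        have "(l has_derivative (\<lambda>s. s *\<^sub>R (b - a))) (at t within {0..1})"
          unfolding l_def by (auto intro!: derivative_eq_intros)
        moreover have "(y j has_derivative D) (at (l t) within l ` {0..1})"
          by (rule has_derivative_subset[OF D(1)]) (use l T(2) in auto)
        ultimately have "((\<lambda>t. y j (l t)) has_derivative (\<lambda>s. D (s *\<^sub>R (b - a)))) (at t within {0..1})"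
          by (rule has_derivative_in_compose)
        moreover have "D (s *\<^sub>R (b - a)) = s *\<^sub>R D (b - a)" for s
          by (rule linear_scale[OF has_derivative_linear[OF D(1)]])
        ultimately show ?thesis by (simp add: has_vector_derivative_def bspec[OF D(2) h])
      qed
      show "continuous_on {0..1} (\<lambda>t. A (l t) (b - a) k j)" if "k < d" "j < d" for k j
        by (rule continuous_on_compose2[OF A[OF h that]])
          (use l T(2) in \<open>auto simp: l_def intro!: continuous_intros\<close>)
      show "y j (l 0) = 0" if "j < d" for j using \<open>Z a\<close> that by (simp add: Z_def l_def)
    qed (use that in auto)
    then show ?thesis by (simp add: Z_def l_def)
  qed
  have "Z constant_on U"
  proof (rule locally_constant_imp_constant[OF \<open>connected U\<close>])
    fix a assume "a \<in> U"
    then obtain T where T: "convex T" "openin (top_of_set U) T" "a \<in> T" "T \<subseteq> U"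
      using openin_subspace_convex_nhd[OF E] by blast
    \<comment> \<open>Each segment is used in both directions: zeros spread from \<open>a\<close> to
      \<open>x\<close>, and a zero at \<open>x\<close> would spread back to
      \<open>a\<close>.\<close>
    with seg have "\<forall>x\<in>T. Z x = Z a" by blast
    with T show "\<exists>T. openin (top_of_set U) T \<and> a \<in> T \<and> (\<forall>x\<in>T. Z x = Z a)" by blast
  qed
  then show ?thesis using assms unfolding constant_on_def Z_def by blast
qed

section \<open>Logarithmic derivatives and Liouville's formula\<close>

text \<open>Dividing by \<open>f p\<close> moves the values close to 1, where \<open>Ln\<close> is
  differentiable. Near \<open>p\<close> the branch equals \<open>L p + Ln (f q / f p)\<close>,
  because continuity of \<open>L\<close> rules out a jump by a multiple of 2 pi i.\<close>

lemma has_derivative_log_branch: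
  fixes f :: "'p::real_normed_vector \<Rightarrow> complex"
  assumes L: "log_branch_on U f L" and p: "p \<in> U" and f: "(f has_derivative f') (at p within U)"
  shows "(L has_derivative (\<lambda>h. f' h / f p)) (at p within U)"
proof -
  have expL: "exp (L q) = f q" if "q \<in> U" for q using L that by (simp add: log_branch_on_def)
  have fp: "f p \<noteq> 0" using expL[OF p] exp_not_eq_zero[of "L p"] by simp
  have "((\<lambda>q. f q / f p) has_derivative (\<lambda>h. f' h / f p)) (at p within U)"
    by (rule bounded_linear.has_derivative[OF bounded_linear_divide f])
  moreover have "(Ln has_derivative (*) (inverse (f p / f p))) (at (f p / f p) within (\<lambda>q. f q / f p) ` U)"
    by (rule has_derivative_at_withinI, rule has_field_derivative_imp_has_derivative,
        rule has_field_derivative_Ln) (simp add: fp)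
  ultimately have "((\<lambda>q. Ln (f q / f p)) has_derivative (\<lambda>h. inverse (f p / f p) * (f' h / f p))) (at p within U)"
    by (rule has_derivative_in_compose)
  from has_derivative_add[OF has_derivative_const[of "L p"] this]
  have *: "((\<lambda>q. L p + Ln (f q / f p)) has_derivative (\<lambda>h. f' h / f p)) (at p within U)"
    by (simp add: fp)
  have "(L \<longlongrightarrow> L p) (at p within U)"
    using L p by (simp add: log_branch_on_def continuous_on_def)
  \<comment> \<open>The radius \<open>pi\<close> keeps the imaginary part of
    \<open>L q - L p\<close> in the principal strip, where \<open>Ln\<close> inverts
    \<open>exp\<close>.\<close>
  then have "\<forall>\<^sub>F q in at p within U. dist (L q) (L p) < pi"
    by (rule tendstoD) simp
  then have "\<forall>\<^sub>F q in at p within U. L p + Ln (f q / f p) = L q"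
    unfolding eventually_at_filter
  proof (rule eventually_mono, intro impI)
    fix q assume "q \<noteq> p \<longrightarrow> q \<in> U \<longrightarrow> dist (L q) (L p) < pi" "q \<noteq> p" "q \<in> U"
    then have "\<bar>Im (L q - L p)\<bar> < pi"
      using abs_Im_le_cmod[of "L q - L p"] by (simp add: dist_norm)
    then have "Ln (exp (L q - L p)) = L q - L p" by (intro Ln_exp) linarith+
    then show "L p + Ln (f q / f p) = L q" by (simp add: exp_diff expL p \<open>q \<in> U\<close>)
  qed
  then show ?thesis
    by (rule has_derivative_transform_eventually[OF *]) (simp_all add: p fp)
qed

text \<open>The rows of \<open>Y\<close> are the solutions and \<open>A p h\<close> multiplies them
  from the right. The assumption \<open>independent\<close> concerns functions on \<open>U\<close>,
  whereas a nonzero determinant asks for independence at one point;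
  \<open>linear_system_zero\<close> closes this gap.\<close>

lemma liouville_formula:
  fixes Y :: "nat \<Rightarrow> nat \<Rightarrow> 'p::real_normed_vector \<Rightarrow> complex"
  assumes E: "subspace E" "openin (top_of_set E) U" and "connected U" and "U \<noteq> {}"
    and Y: "\<And>p i j. p \<in> U \<Longrightarrow> i < d \<Longrightarrow> j < d \<Longrightarrow> \<exists>D. (Y i j has_derivative D) (at p within U) \<and>
        (\<forall>h\<in>E. D h = (\<Sum>k<d. Y i k p * A p h k j))"
    and A: "\<And>h k j. h \<in> E \<Longrightarrow> k < d \<Longrightarrow> j < d \<Longrightarrow> continuous_on U (\<lambda>p. A p h k j)"
    and independent: "\<And>c. (\<And>p j. p \<in> U \<Longrightarrow> j < d \<Longrightarrow> (\<Sum>i<d. c i * Y i j p) = 0) \<Longrightarrow> \<forall>i<d. c i = 0"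
    and l: "\<And>p. p \<in> U \<Longrightarrow> \<exists>D. (l has_derivative D) (at p within U) \<and>
        (\<forall>h\<in>E. D h = (\<Sum>k<d. A p h k k))"
  shows "\<exists>C. C \<noteq> 0 \<and> (\<forall>p\<in>U. Determinant.det (Matrix.mat d d (\<lambda>(i, j). Y i j p)) = C * exp (l p))"
proof -
  define W where "W p = Determinant.det (Matrix.mat d d (\<lambda>(i, j). Y i j p))" for p
  have "(\<lambda>p. W p * exp (- l p)) constant_on U"
  proof (rule zero_derivative_along_subspace_constant[OF E \<open>connected U\<close>])
    fix p assume p: "p \<in> U"
    define Y' where "Y' i j = (SOME D. (Y i j has_derivative D) (at p within U) \<and>
        (\<forall>h\<in>E. D h = (\<Sum>k<d. Y i k p * A p h k j)))" for i j
    have Y': "(Y i j has_derivative Y' i j) (at p within U)"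
        "\<forall>h\<in>E. Y' i j h = (\<Sum>k<d. Y i k p * A p h k j)" if "i < d" "j < d" for i j
      using someI_ex[OF Y[OF p that]] unfolding Y'_def by blast+
    have "\<exists>D. (W has_derivative D) (at p within U) \<and>
        (\<forall>h B. (\<forall>i<d. \<forall>j<d. Y' i j h = (\<Sum>k<d. Y i k p * B k j)) \<longrightarrow>
          D h = (\<Sum>k<d. B k k) * W p)"
      unfolding W_def by (rule has_derivative_det) (rule Y'(1))
    then obtain D where D0: "(W has_derivative D) (at p within U) \<and>
        (\<forall>h B. (\<forall>i<d. \<forall>j<d. Y' i j h = (\<Sum>k<d. Y i k p * B k j)) \<longrightarrow>
          D h = (\<Sum>k<d. B k k) * W p)" ..
    have D: "D h = (\<Sum>k<d. A p h k k) * W p" if "h \<in> E" for h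
      by (rule D0[THEN conjunct2, rule_format, of h "A p h"]) (rule bspec[OF Y'(2) that])
    obtain l' where l': "(l has_derivative l') (at p within U)"
        "\<And>h. h \<in> E \<Longrightarrow> l' h = (\<Sum>k<d. A p h k k)"
      using l[OF p] by blast
    have "((\<lambda>z. exp (- z)) has_derivative (\<lambda>h. - exp (- l p) * h)) (at (l p) within l ` U)"
      unfolding has_field_derivative_def[symmetric]
      by (rule DERIV_cong[OF DERIV_chain2[OF DERIV_exp DERIV_minus[OF DERIV_ident]]]) simp
    from has_derivative_in_compose[OF l'(1) this]
    have "((\<lambda>q. exp (- l q)) has_derivative (\<lambda>h. - exp (- l p) * l' h)) (at p within U)" .
    with conjunct1[OF D0] have "((\<lambda>q. W q * exp (- l q)) has_derivative
        (\<lambda>h. W p * (- exp (- l p) * l' h) + D h * exp (- l p))) (at p within U)"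
      by (rule has_derivative_mult)
    then show "\<exists>f'. ((\<lambda>q. W q * exp (- l q)) has_derivative f') (at p within U) \<and> (\<forall>h\<in>E. f' h = 0)"
      by (rule exI[of _ "\<lambda>h. W p * (- exp (- l p) * l' h) + D h * exp (- l p)", OF conjI])
        (simp add: D l'(2))
  qed
  then obtain C where C: "\<And>p. p \<in> U \<Longrightarrow> W p * exp (- l p) = C"
    unfolding constant_on_def by blast
  obtain p0 where p0: "p0 \<in> U" using \<open>U \<noteq> {}\<close> by blast
  have "W p0 \<noteq> 0"
  proof
    let ?M = "Matrix.mat d d (\<lambda>(i, j). Y i j p0)"
    assume "W p0 = 0"
    \<comment> \<open>Solutions are rows, so a linear relation among them at \<open>p0\<close> is a
      vector in the kernel of the transpose.\<close>
    then have "Determinant.det (transpose_mat ?M) = 0"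
      using Determinant.det_transpose[of ?M d] by (simp add: W_def)
    then obtain w where w: "w \<in> carrier_vec d" "w \<noteq> 0\<^sub>v d" "transpose_mat ?M *\<^sub>v w = 0\<^sub>v d"
      using Determinant.det_0_iff_vec_prod_zero[of "transpose_mat ?M" d] by auto
    define c where "c i = vec_index w i" for i
    have "(\<Sum>i<d. c i * Y i j p0) = 0" if "j < d" for j
    proof -
      have "vec_index (transpose_mat ?M *\<^sub>v w) j = 0" using w(3) that by simp
      then show ?thesis using that w(1)
        by (simp add: scalar_prod_def c_def mult.commute lessThan_atLeast0)
    qed
    note zero = this
    have "(\<Sum>i<d. c i * Y i j p) = 0" if "p \<in> U" "j < d" for p j
    proof (rule linear_system_zero[where y = "\<lambda>j p. \<Sum>i<d. c i * Y i j p", OF E \<open>connected U\<close> _ A p0 zero])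
      fix p j assume p: "p \<in> U" "j < d"
      define Y' where "Y' i = (SOME D. (Y i j has_derivative D) (at p within U) \<and>
          (\<forall>h\<in>E. D h = (\<Sum>k<d. Y i k p * A p h k j)))" for i
      have Y': "(Y i j has_derivative Y' i) (at p within U)"
          "\<forall>h\<in>E. Y' i h = (\<Sum>k<d. Y i k p * A p h k j)" if "i < d" for i
        using someI_ex[OF Y[OF p(1) that p(2)]] unfolding Y'_def by blast+
      have "((\<lambda>p. \<Sum>i<d. c i * Y i j p) has_derivative (\<lambda>h. \<Sum>i<d. c i * Y' i h)) (at p within U)"
        by (intro has_derivative_sum has_derivative_mult_right Y') simp
      moreover have "(\<Sum>i<d. c i * Y' i h) = (\<Sum>k<d. (\<Sum>i<d. c i * Y i k p) * A p h k j)" if "h \<in> E" for h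
      proof -
        have "(\<Sum>i<d. c i * Y' i h) = (\<Sum>i<d. \<Sum>k<d. c i * Y i k p * A p h k j)"
          using that Y'(2) by (simp add: sum_distrib_left mult.assoc)
        also have "\<dots> = (\<Sum>k<d. \<Sum>i<d. c i * Y i k p * A p h k j)" by (rule sum.swap)
        finally show ?thesis by (simp add: sum_distrib_right)
      qed
      ultimately show "\<exists>D. ((\<lambda>p. \<Sum>i<d. c i * Y i j p) has_derivative D) (at p within U) \<and>
          (\<forall>h\<in>E. D h = (\<Sum>k<d. (\<Sum>i<d. c i * Y i k p) * A p h k j))" by blast
    qed (use that in auto)
    then have "\<forall>i<d. c i = 0" by (rule independent)
    then have "w = 0\<^sub>v d" using w(1) by (auto simp: c_def intro!: Matrix.eq_vecI)
    with w(2) show False by simp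
  qed
  then have "C \<noteq> 0" using C[OF p0] by (metis exp_not_eq_zero mult_eq_0_iff)
  moreover have "W p = C * exp (l p)" if "p \<in> U" for p
    unfolding C[OF that, symmetric] by (simp add: exp_minus)
  ultimately show ?thesis unfolding W_def by blast
qed

section \<open>Traces on tensor products of modules\<close>

text \<open>The coordinates on \<open>W\<close> are wanted as functionals on the whole space,
  because \<open>has_vderiv\<close> and \<open>vdifferentiable_on\<close> test with such
  functionals. Hence the basis of \<open>W\<close> is first extended to a basis of
  everything.\<close>

lemma basis_coordinates:
  assumes "vector_space s" and v: "basis_of s W d v"
  obtains \<phi> where "\<And>j. Vector_Spaces.linear s (*) (\<phi> j)"
    and "\<And>j k. j < d \<Longrightarrow> k < d \<Longrightarrow> \<phi> j (v k) = (if j = k then 1 else 0)"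
    and "\<And>w. w \<in> W \<Longrightarrow> w = (\<Sum>k<d. s (\<phi> k w) (v k))"
proof -
  interpret vector_space s by fact
  have v: "inj_on v {..<d}" "independent (v ` {..<d})" "span (v ` {..<d}) = W"
    using v by (auto simp: basis_of_def)
  define B where "B = extend_basis (v ` {..<d})"
  have B: "independent B" "span B = UNIV" "v ` {..<d} \<subseteq> B"
    unfolding B_def using v(2)
    by (simp_all add: independent_extend_basis extend_basis_superset)
  define \<phi> where "\<phi> j x = representation B x (v j)" for j x
  have lin: "Vector_Spaces.linear s (*) (\<phi> j)" for j
    unfolding Vector_Spaces.linear_iff
    by (simp add: \<phi>_def representation_add representation_scale B vector_space_axioms
        vector_space_over_itself.vector_space_axioms)
  have delta: "\<phi> j (v k) = (if j = k then 1 else 0)" if "j < d" "k < d" for j k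
  proof -
    have "v k \<in> B" and "v j = v k \<longleftrightarrow> j = k"
      using that B(3) inj_on_eq_iff[OF v(1), of j k] by auto
    then show ?thesis using representation_basis[OF B(1), of "v k"] by (simp add: \<phi>_def)
  qed
  have expand: "w = (\<Sum>k<d. s (\<phi> k w) (v k))" if "w \<in> W" for w
  proof -
    let ?R = "representation (v ` {..<d})"
    have w: "w \<in> span (v ` {..<d})" using that v(3) by simp
    have "\<phi> k w = ?R w (v k)" for k
      by (simp add: \<phi>_def representation_extend[OF B(1) w B(3)])
    moreover have "w = (\<Sum>b\<in>v ` {..<d}. s (?R w b) b)"
      by (simp add: sum_representation_eq[OF v(2) w])
    ultimately show ?thesis using v(1) by (simp add: sum.reindex)
  qed
  show thesis by (rule that[OF lin delta expand])
qed

text \<open>\<open>trace_on\<close> uses an unspecified basis \<open>B\<close>. Expanding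
  \<open>f b\<close> in the vectors \<open>v k\<close> and exchanging the sums reassembles each
  \<open>v k\<close> from its expansion in \<open>B\<close>, which is the usual proof that the trace
  does not depend on the basis.\<close>

lemma trace_on_eq_sum_coordinates:
  assumes "vector_space s" and v: "basis_of s W d v"
    and f: "Vector_Spaces.linear s s f" "\<And>w. w \<in> W \<Longrightarrow> f w \<in> W"
    and \<phi>: "\<And>j. Vector_Spaces.linear s (*) (\<phi> j)"
      "\<And>w. w \<in> W \<Longrightarrow> w = (\<Sum>k<d. s (\<phi> k w) (v k))"
  shows "trace_on s W f = (\<Sum>k<d. \<phi> k (f (v k)))"
proof -
  interpret vector_space s by fact
  have v: "independent (v ` {..<d})" "span (v ` {..<d}) = W"
    using v by (auto simp: basis_of_def)
  define B where "B = (SOME B. independent B \<and> span B = W)"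
  have B: "independent B" "span B = W"
    using someI_ex[of "\<lambda>B. independent B \<and> span B = W"] v unfolding B_def by blast+
  have "finite B"
    using independent_span_bound[OF _ B(1), of "v ` {..<d}"] span_superset[of B] B(2) v(2) by simp
  let ?R = "representation B"
  have \<phi>f: "Vector_Spaces.linear s (*) (\<lambda>x. \<phi> k (f x))" for k
    using Vector_Spaces.linear_compose[OF f(1) \<phi>(1)] by (simp add: comp_def)
  have vW: "v k \<in> span B" if "k < d" for k
    using that v(2) B(2) span_base[of "v k" "v ` {..<d}"] by auto
  have "trace_on s W f = (\<Sum>b\<in>B. ?R (f b) b)"
    by (simp add: trace_on_def B_def Let_def)
  also have "\<dots> = (\<Sum>b\<in>B. \<Sum>k<d. \<phi> k (f b) * ?R (v k) b)"
  proof (intro sum.cong refl)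
    fix b assume "b \<in> B"
    then have "f b \<in> W" using f(2) span_base B(2) by blast
    then have "?R (f b) = ?R (\<Sum>k<d. s (\<phi> k (f b)) (v k))" using \<phi>(2) by metis
    also have "\<dots> = (\<lambda>b'. \<Sum>k<d. ?R (s (\<phi> k (f b)) (v k)) b')"
      by (rule representation_sum[OF B(1)]) (simp add: span_scale vW)
    also have "\<dots> = (\<lambda>b'. \<Sum>k<d. \<phi> k (f b) * ?R (v k) b')"
      by (simp add: representation_scale[OF B(1)] vW)
    finally show "?R (f b) b = (\<Sum>k<d. \<phi> k (f b) * ?R (v k) b)" by simp
  qed
  also have "\<dots> = (\<Sum>k<d. \<phi> k (f (\<Sum>b\<in>B. s (?R (v k) b) b)))"
  proof (subst sum.swap, intro sum.cong refl)
    fix k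
    interpret F: Vector_Spaces.linear s "(*)" "\<lambda>x. \<phi> k (f x)" by (rule \<phi>f)
    show "(\<Sum>b\<in>B. \<phi> k (f b) * ?R (v k) b) = \<phi> k (f (\<Sum>b\<in>B. s (?R (v k) b) b))"
      by (simp add: F.sum F.scale mult.commute)
  qed
  also have "\<dots> = (\<Sum>k<d. \<phi> k (f (v k)))"
    by (intro sum.cong refl) (simp add: sum_representation_eq[OF B(1)] vW \<open>finite B\<close>)
  finally show ?thesis .
qed

text \<open>Pure tensors span, so the identities for \<open>act\<close> below only need to be
  checked on them.\<close>

lemma tensor_product_ext:
  assumes tp: "tensor_product sv V st \<tau>"
    and F: "Vector_Spaces.linear st sw F" and G: "Vector_Spaces.linear st sw G"
    and eq: "\<And>w. w \<in> Pi UNIV V \<Longrightarrow> F (\<tau> w) = G (\<tau> w)"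
  shows "F x = G x"
proof -
  interpret F: Vector_Spaces.linear st sw F by (rule F)
  interpret vector_space_pair st sw ..
  show ?thesis
    by (rule linear_eq_on[OF F G, where B = "\<tau> ` Pi UNIV V"])
      (use tp eq in \<open>auto simp: tensor_product_def\<close>)
qed

section \<open>Roots and the invariant form\<close>

context root_decomposition
begin

lemma form_right: "form x (y + z) = form x y + form x z" "form x (sg c y) = c * form x y"
  using form_linear[of x] by (simp_all add: Vector_Spaces.linear_iff)

lemma form_left: "form (y + z) x = form y x + form z x" "form (sg c y) x = c * form y x"
  by (simp_all add: form_sym[of _ x] form_right)

lemma form_zero_right: "form x 0 = 0"
  using form_right(2)[of x 0 0] by simp

lemma form_sum_right: "form x (\<Sum>i\<in>I. f i) = (\<Sum>i\<in>I. form x (f i))"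
  by (induction I rule: infinite_finite_induct) (simp_all add: form_right form_zero_right)

lemma br_add_left: "br (x + y) z = br x z + br y z" and br_scale_left: "br (sg c x) z = sg c (br x z)"
  using br_linear_left[of z] by (simp_all add: Vector_Spaces.linear_iff)

lemma br_root: "\<alpha> \<in> roots sg br H \<Longrightarrow> h \<in> H \<Longrightarrow> br h (e \<alpha>) = sg (\<alpha> h) (e \<alpha>)"
  using e_root_space by (auto simp: root_space_def)

lemma root_dual: "\<alpha> \<in> roots sg br H \<Longrightarrow> \<alpha> \<in> dual_of sg H"
  by (simp add: roots_def)

lemma br_antisym: "br x y = - br y x"
proof -
  have r: "br z (x + y) = br z x + br z y" for z x y
    using br_linear_right[of z] by (simp add: Vector_Spaces.linear_iff)
  have "br (x + y) (x + y) = br x x + br y x + (br x y + br y y)"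
    by (simp only: r br_add_left)
  then have "br x y + br y x = br (x + y) (x + y)"
    by (simp only: br_alternating[of x] br_alternating[of y] add_0_left add_0_right add.commute)
  also have "\<dots> = 0" by (rule br_alternating)
  finally show ?thesis by (rule eq_neg_iff_add_eq_0[THEN iffD2])
qed

lemma form_uminus_left: "form (- x) y = - form x y"
  using form_left(2)[of "-1" x y] by (simp add: scale_minus_left)

text \<open>By invariance \<open>e \<alpha>\<close> is orthogonal to \<open>H\<close> and to every
  \<open>e \<beta>\<close> with \<alpha> + \<beta> \<noteq> 0. If -\<alpha> were no root,
  \<open>e \<alpha>\<close> would be orthogonal to everything. The normalization
  \<open>form_e\<close> does not settle this directly, because \<open>e\<close> is a total function
  and \<open>e (- \<alpha>)\<close> is some vector in any case.\<close>

lemma uminus_root: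
  assumes \<alpha>: "\<alpha> \<in> roots sg br H"
  shows "- \<alpha> \<in> roots sg br H"
proof (rule ccontr)
  assume not_root: "- \<alpha> \<notin> roots sg br H"
  \<comment> \<open>Moving \<open>h\<close> across the form treats root vectors and, with \<beta> =
    0, elements of \<open>H\<close> alike.\<close>
  have orth: "(\<alpha> h + \<beta> h) * form (e \<alpha>) y = 0"
    if "h \<in> H" "br h y = sg (\<beta> h) y" for h \<beta> y
  proof -
    have "\<alpha> h * form (e \<alpha>) y = form (br h (e \<alpha>)) y"
      using br_root[OF \<alpha> that(1)] by (simp add: form_left)
    also have "\<dots> = - form (br (e \<alpha>) h) y"
      by (subst br_antisym) (rule form_uminus_left)
    also have "\<dots> = - (\<beta> h * form (e \<alpha>) y)"
      using that(2) by (simp add: form_invariant form_right)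
    finally show ?thesis by (simp add: algebra_simps)
  qed
  have H0: "form (e \<alpha>) h' = 0" if "h' \<in> H" for h'
  proof -
    have "\<alpha> \<noteq> (\<lambda>_. 0)" using \<alpha> by (simp add: roots_def)
    then obtain h where "\<alpha> h \<noteq> 0" by blast
    moreover from this have "h \<in> H"
      using root_dual[OF \<alpha>] by (force simp: dual_of_def)
    ultimately show ?thesis
      using orth[of h h' "\<lambda>_. 0"] abelian_H[OF _ that] by simp
  qed
  have e0: "form (e \<alpha>) (e \<beta>) = 0" if \<beta>: "\<beta> \<in> roots sg br H" for \<beta>
  proof -
    have "\<beta> \<noteq> - \<alpha>" using \<beta> not_root by blast
    then obtain h where h: "\<alpha> h + \<beta> h \<noteq> 0"
      by (auto simp: fun_eq_iff add_eq_0_iff)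
    \<comment> \<open>Roots vanish outside \<open>H\<close> by their representation, so a point
      where \<alpha> + \<beta> is nonzero must lie in \<open>H\<close>.\<close>
    have "h \<in> H"
    proof (rule ccontr)
      assume "h \<notin> H"
      then have "\<alpha> h = 0" "\<beta> h = 0"
        using root_dual[OF \<alpha>] root_dual[OF \<beta>] by (auto simp: dual_of_def)
      with h show False by simp
    qed
    with h show ?thesis using orth[of h "e \<beta>" \<beta>] br_root[OF \<beta>] by simp
  qed
  have "form (e \<alpha>) x = 0" for x
  proof -
    obtain h c where "h \<in> H" "x = h + (\<Sum>\<beta>\<in>roots sg br H. sg (c \<beta>) (e \<beta>))"
      using direct_sum[of x] by blast
    then show ?thesis by (simp add: form_right form_sum_right H0 e0)
  qed
  then show False using form_e[OF \<alpha>] by simp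
qed

text \<open>Extends a root linearly from \<open>H\<close> to the whole algebra.\<close>

lemma root_eq_form:
  assumes "\<alpha> \<in> roots sg br H" "h \<in> H"
  shows "\<alpha> h = form (br h (e \<alpha>)) (e (- \<alpha>))"
  using assms form_e by (simp add: br_root form_left)

end

section \<open>The action of the Lie algebra on the factors of a tensor product\<close>

locale lie_module_tensor_product = lie_algebra sg br
  for sg :: "complex \<Rightarrow> 'g \<Rightarrow> 'g::ab_group_add" and br +
  fixes sv :: "complex \<Rightarrow> 'v \<Rightarrow> 'v::ab_group_add"
    and V :: "'n::finite \<Rightarrow> 'v set"
    and \<rho> :: "'n \<Rightarrow> 'g \<Rightarrow> 'v \<Rightarrow> 'v"
    and st :: "complex \<Rightarrow> 't \<Rightarrow> 't::ab_group_add"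
    and \<tau> :: "('n \<Rightarrow> 'v) \<Rightarrow> 't"
    and act :: "'n \<Rightarrow> 'g \<Rightarrow> 't \<Rightarrow> 't"
  assumes modules: "\<And>i. lie_module sg br sv (V i) (\<rho> i)"
    and tensor: "tensor_product sv V st \<tau>"
    and factor: "factor_action st V \<rho> \<tau> act"
begin

sublocale T: vector_space st
  using tensor by (simp add: tensor_product_def)

lemma act_linear: "Vector_Spaces.linear st st (act i x)"
  using factor by (simp add: factor_action_def)

lemma act_right: "act i x (u + w) = act i x u + act i x w" "act i x (st c u) = st c (act i x u)"
  using act_linear[of i x] by (simp_all add: Vector_Spaces.linear_iff)

lemma act_sum_right: "act i x (\<Sum>k\<in>K. f k) = (\<Sum>k\<in>K. act i x (f k))"
proof -
  interpret L: Vector_Spaces.linear st st "act i x" by (rule act_linear)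
  show ?thesis by (rule L.sum)
qed

lemma act_pure: "w \<in> Pi UNIV V \<Longrightarrow> act i x (\<tau> w) = \<tau> (w(i := \<rho> i x (w i)))"
  using factor by (simp add: factor_action_def)

lemma rho_closed: "w \<in> V i \<Longrightarrow> \<rho> i x w \<in> V i"
  using modules[of i] by (auto simp: lie_module_def)

lemma pure_closed: "w \<in> Pi UNIV V \<Longrightarrow> w(i := \<rho> i x (w i)) \<in> Pi UNIV V"
  by (auto simp: Pi_iff rho_closed)

lemma pure_add: "w \<in> Pi UNIV V \<Longrightarrow> a \<in> V i \<Longrightarrow> b \<in> V i \<Longrightarrow>
    \<tau> (w(i := a + b)) = \<tau> (w(i := a)) + \<tau> (w(i := b))"
  and pure_scale: "w \<in> Pi UNIV V \<Longrightarrow> a \<in> V i \<Longrightarrow> \<tau> (w(i := sv c a)) = st c (\<tau> (w(i := a)))"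
  using tensor by (auto simp: tensor_product_def multilinear_on_def)

lemma act_add_left: "act i (x + y) u = act i x u + act i y u"
proof (rule tensor_product_ext[OF tensor, where F = "act i (x + y)" and G = "\<lambda>u. act i x u + act i y u"])
  show "Vector_Spaces.linear st st (\<lambda>u. act i x u + act i y u)"
    unfolding Vector_Spaces.linear_iff
    by (simp add: T.vector_space_axioms act_right T.scale_right_distrib)
  fix w assume w: "w \<in> Pi UNIV V"
  have "\<rho> i (x + y) (w i) = \<rho> i x (w i) + \<rho> i y (w i)"
    using modules[of i] Pi_mem[OF w UNIV_I, of i] by (auto simp: lie_module_def)
  then show "act i (x + y) (\<tau> w) = act i x (\<tau> w) + act i y (\<tau> w)"
    using w by (simp add: act_pure pure_add rho_closed Pi_iff)
qed (rule act_linear)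

lemma act_scale_left: "act i (sg c x) u = st c (act i x u)"
proof (rule tensor_product_ext[OF tensor, where F = "act i (sg c x)" and G = "\<lambda>u. st c (act i x u)"])
  show "Vector_Spaces.linear st st (\<lambda>u. st c (act i x u))"
    unfolding Vector_Spaces.linear_iff
    by (simp add: T.vector_space_axioms act_right T.scale_right_distrib mult.commute)
  fix w assume w: "w \<in> Pi UNIV V"
  have "\<rho> i (sg c x) (w i) = sv c (\<rho> i x (w i))"
    using modules[of i] Pi_mem[OF w UNIV_I, of i] by (auto simp: lie_module_def)
  then show "act i (sg c x) (\<tau> w) = st c (act i x (\<tau> w))"
    using w by (simp add: act_pure pure_scale rho_closed Pi_iff)
qed (rule act_linear)

lemma act_linear_compose: "Vector_Spaces.linear st st (\<lambda>u. act i x (act j y u))"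
  using Vector_Spaces.linear_compose[OF act_linear act_linear] by (simp add: comp_def)

lemma act_commute:
  assumes "i \<noteq> j"
  shows "act i x (act j y u) = act j y (act i x u)"
proof (rule tensor_product_ext[OF tensor,
    where F = "\<lambda>u. act i x (act j y u)" and G = "\<lambda>u. act j y (act i x u)"])
  fix w assume w: "w \<in> Pi UNIV V"
  then show "act i x (act j y (\<tau> w)) = act j y (act i x (\<tau> w))"
    using assms by (simp add: act_pure pure_closed fun_upd_twist)
qed (rule act_linear_compose)+

lemma act_bracket: "act i (br x y) u = act i x (act i y u) - act i y (act i x u)"
proof -
  \<comment> \<open>Without subtraction the identity reduces on pure tensors to additivity in the
    factor \<open>i\<close>.\<close>
  have "act i (br x y) u + act i y (act i x u) = act i x (act i y u)"
  proof (rule tensor_product_ext[OF tensor,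
      where F = "\<lambda>u. act i (br x y) u + act i y (act i x u)" and G = "\<lambda>u. act i x (act i y u)"])
    show "Vector_Spaces.linear st st (\<lambda>u. act i (br x y) u + act i y (act i x u))"
      unfolding Vector_Spaces.linear_iff
      by (simp add: T.vector_space_axioms act_right T.scale_right_distrib)
    fix w assume w: "w \<in> Pi UNIV V"
    have "\<rho> i (br x y) (w i) + \<rho> i y (\<rho> i x (w i)) = \<rho> i x (\<rho> i y (w i))"
      using modules[of i] Pi_mem[OF w UNIV_I, of i] by (auto simp: lie_module_def)
    moreover have "\<tau> (w(i := \<rho> i (br x y) (w i) + \<rho> i y (\<rho> i x (w i)))) =
        \<tau> (w(i := \<rho> i (br x y) (w i))) + \<tau> (w(i := \<rho> i y (\<rho> i x (w i))))"
      using w by (intro pure_add rho_closed) auto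
    ultimately show "act i (br x y) (\<tau> w) + act i y (act i x (\<tau> w)) = act i x (act i y (\<tau> w))"
      using w by (simp add: act_pure pure_closed)
  qed (rule act_linear_compose)
  then show ?thesis by (simp add: eq_diff_eq)
qed

lemma total_action_linear: "Vector_Spaces.linear st st (total_action act x)"
  unfolding Vector_Spaces.linear_iff total_action_def
  by (simp add: T.vector_space_axioms act_right sum.distrib T.scale_sum_right)

text \<open>Only the summand of the factor \<open>i\<close> fails to commute with
  \<open>act i y\<close>, and it contributes the bracket. For \<open>x\<close> in \<open>H\<close>
  and \<open>y\<close> a root vector this is what makes weights add in
  \<open>act_weight_space\<close>.\<close>

lemma total_action_act:
  "total_action act x (act i y u) = act i y (total_action act x u) + act i (br x y) u"
proof -
  have "act j x (act i y u) = act i y (act j x u) + (if j = i then act i (br x y) u else 0)" for j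
    by (cases "j = i") (auto simp: act_bracket act_commute)
  then show ?thesis
    unfolding total_action_def act_sum_right by (simp add: sum.distrib)
qed

lemma subspace_weight_space: "T.subspace (weight_space st H act \<nu>)"
proof -
  interpret L: Vector_Spaces.linear st st "total_action act x" for x by (rule total_action_linear)
  show ?thesis
    by (rule T.subspaceI)
      (auto simp: weight_space_def L.zero L.add L.scale T.scale_right_distrib T.scale_left_commute)
qed

lemma act_weight_space:
  assumes x: "x \<in> root_space sg br H \<beta>" and u: "u \<in> weight_space st H act \<nu>"
  shows "act i x u \<in> weight_space st H act (\<lambda>h. \<nu> h + \<beta> h)"
  using assms
  by (auto simp: weight_space_def root_space_def total_action_act act_right act_scale_left
      T.scale_left_distrib)

lemma total_action_weight_space:
  assumes "x \<in> root_space sg br H \<beta>" "u \<in> weight_space st H act \<nu>"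
  shows "total_action act x u \<in> weight_space st H act (\<lambda>h. \<nu> h + \<beta> h)"
  unfolding total_action_def
  by (intro T.subspace_sum subspace_weight_space act_weight_space assms)

end

section \<open>The operators of the system on a weight space\<close>

locale root_decomposition_tensor_product =
  root_decomposition sg br form H e + lie_module_tensor_product sg br sv V \<rho> st \<tau> act
  for sg :: "complex \<Rightarrow> 'g \<Rightarrow> 'g::euclidean_space" and br form H e
    and sv :: "complex \<Rightarrow> 'v \<Rightarrow> 'v::ab_group_add" and V :: "'n::finite \<Rightarrow> 'v set" and \<rho>
    and st :: "complex \<Rightarrow> 't \<Rightarrow> 't::ab_group_add" and \<tau> act
begin

lemma cartan_act_weight_space:
  assumes "h \<in> H" "u \<in> weight_space st H act \<nu>"
  shows "act i h u \<in> weight_space st H act \<nu>"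
  using act_weight_space[of h H "\<lambda>_. 0" u \<nu> i] assms abelian_H by (simp add: root_space_def)

text \<open>The shifts by -\<alpha> and \<alpha> cancel; \<open>uminus_root\<close> guarantees that
  \<open>e (- \<alpha>)\<close> really is a root vector.\<close>

lemma root_act_weight_space:
  assumes "\<alpha> \<in> roots sg br H" "u \<in> weight_space st H act \<nu>"
  shows "act i (e \<alpha>) (act j (e (- \<alpha>)) u) \<in> weight_space st H act \<nu>"
  using act_weight_space[OF e_root_space[OF assms(1)]
      act_weight_space[OF e_root_space[OF uminus_root[OF assms(1)]] assms(2)]] by simp

lemma root_total_action_weight_space:
  assumes "\<alpha> \<in> roots sg br H" "u \<in> weight_space st H act \<nu>"
  shows "total_action act (e (- \<alpha>)) (total_action act (e \<alpha>) u) \<in> weight_space st H act \<nu>"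
  using total_action_weight_space[OF e_root_space[OF uminus_root[OF assms(1)]]
      total_action_weight_space[OF e_root_space[OF assms(1)] assms(2)]] by simp

lemma Omega_linear: "Vector_Spaces.linear st st (Omega R e r hs act i j)"
  unfolding Vector_Spaces.linear_iff Omega_def
  by (simp add: T.vector_space_axioms act_right sum.distrib T.scale_sum_right T.scale_right_distrib)

lemma Omega_weight_space:
  assumes "\<And>s. s < r \<Longrightarrow> hs s \<in> H" "u \<in> weight_space st H act \<nu>"
  shows "Omega (roots sg br H) e r hs act i j u \<in> weight_space st H act \<nu>"
  unfolding Omega_def
  by (intro T.subspace_add T.subspace_sum subspace_weight_space cartan_act_weight_space
      root_act_weight_space assms) (simp_all add: assms)

text \<open>Distinct factors commute, and the root part is symmetric under \<alpha> \<mapsto>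
  -\<alpha>. Through the traces this merges the (i, j) and (j, i) terms of the equations in z into
  one logarithmic differential.\<close>

lemma Omega_commute:
  assumes "i \<noteq> j"
  shows "Omega (roots sg br H) e r hs act i j = Omega (roots sg br H) e r hs act j i"
proof
  fix u
  have inv: "- (- \<alpha>) = \<alpha>" for \<alpha> :: "'g \<Rightarrow> complex" by (simp add: fun_eq_iff)
  have "(\<Sum>\<alpha>\<in>roots sg br H. act i (e \<alpha>) (act j (e (- \<alpha>)) u)) =
      (\<Sum>\<alpha>\<in>roots sg br H. act i (e (- \<alpha>)) (act j (e \<alpha>) u))"
    by (rule sum.reindex_bij_witness[where i = uminus and j = uminus])
      (auto simp: uminus_root inv)
  then show "Omega (roots sg br H) e r hs act i j u = Omega (roots sg br H) e r hs act j i u"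
    using assms by (simp add: Omega_def act_commute[of i j])
qed

end

section \<open>The determinant of a basis of solutions\<close>

text \<open>Passes from the real derivative within \<open>U\<close> to the complex derivatives in
  the equations: the chain rule along \<open>c\<close> and uniqueness of the derivative at 0 in the
  complex plane identify the two.\<close>

lemma has_derivative_along_curve:
  fixes f :: "'p::real_normed_vector \<Rightarrow> complex" and c :: "complex \<Rightarrow> 'p"
  assumes f: "(f has_derivative f') (at (c 0) within U)" and c: "(c has_derivative c') (at 0)"
    and U: "openin (top_of_set E) U" "c 0 \<in> U" "\<And>t. c t \<in> E"
    and D: "((\<lambda>t. f (c t)) has_field_derivative D) (at 0)"
  shows "f' (c' t) = D * t"
proof -
  obtain \<epsilon> where "0 < \<epsilon>" and \<epsilon>: "ball (c 0) \<epsilon> \<inter> E \<subseteq> U"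
    using U(1,2) by (force simp: openin_contains_ball)
  have "(c \<longlongrightarrow> c 0) (at 0)"
    using has_derivative_continuous[OF c] by (simp add: isCont_def)
  then have "\<forall>\<^sub>F t in at 0. dist (c t) (c 0) < \<epsilon>"
    using \<open>0 < \<epsilon>\<close> by (rule tendstoD)
  then obtain \<delta> where "0 < \<delta>"
    and \<delta>: "\<forall>t\<in>UNIV. t \<noteq> 0 \<and> dist t 0 < \<delta> \<longrightarrow> dist (c t) (c 0) < \<epsilon>"
    unfolding eventually_at by blast
  \<comment> \<open>The curve is only known to stay in \<open>E\<close>; relative openness keeps it
    in \<open>U\<close> for small parameters.\<close>
  have sub: "c ` ball 0 \<delta> \<subseteq> U"
  proof (intro image_subsetI)
    fix t :: complex assume "t \<in> ball 0 \<delta>"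
    then have "c t \<in> ball (c 0) \<epsilon>"
      using bspec[OF \<delta> UNIV_I, of t] \<open>0 < \<epsilon>\<close> by (cases "t = 0") (simp_all add: dist_commute)
    with \<epsilon> U(3)[of t] show "c t \<in> U" by blast
  qed
  have at0: "at 0 within ball 0 \<delta> = at (0 :: complex)"
    by (rule at_within_open[OF _ open_ball]) (simp add: \<open>0 < \<delta>\<close>)
  have "((\<lambda>t. f (c t)) has_derivative (\<lambda>t. f' (c' t))) (at 0 within ball 0 \<delta>)"
    by (rule has_derivative_in_compose[OF has_derivative_at_withinI[OF c] has_derivative_subset[OF f sub]])
  moreover have "((\<lambda>t. f (c t)) has_derivative (\<lambda>t. D * t)) (at 0)"
    using D by (simp add: has_field_derivative_def)
  ultimately have "(\<lambda>t. f' (c' t)) = (\<lambda>t. D * t)"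
    unfolding at0 by (rule has_derivative_unique)
  then show ?thesis by (rule fun_cong)
qed

lemma bounded_linear_axis: "bounded_linear (axis i :: complex \<Rightarrow> complex ^ 'n::finite)"
  unfolding linear_conv_bounded_linear[symmetric]
  by (rule linearI) (auto simp: axis_def Finite_Cartesian_Product.vec_eq_iff)

lemma prod_sum_axis:
  fixes z :: "complex ^ 'n::finite"
  shows "(x, z) = (x, 0) + (\<Sum>i\<in>UNIV. (0, axis i (vec_nth z i)))"
proof -
  have "vec_nth (\<Sum>i\<in>UNIV. axis i (vec_nth z i)) j = vec_nth z j" for j
    by (simp add: sum_component axis_def)
  then have "(\<Sum>i\<in>UNIV. axis i (vec_nth z i)) = z"
    by (simp add: Finite_Cartesian_Product.vec_eq_iff)
  then show ?thesis by (simp add: sum_prod prod_eq_iff fst_sum snd_sum)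
qed

text \<open>The equations sum over all j \<noteq> i, the product in the theorem runs over i <
  j.\<close>

lemma sum_off_diagonal:
  fixes g :: "'n::{finite,linorder} \<Rightarrow> 'n \<Rightarrow> 'a::comm_monoid_add"
  shows "(\<Sum>i\<in>UNIV. \<Sum>j\<in>UNIV - {i}. g i j) = (\<Sum>(i, j)\<in>{(i, j). i < j}. g i j + g j i)"
proof -
  have "(\<Sum>i\<in>UNIV. \<Sum>j\<in>UNIV - {i}. g i j) = (\<Sum>(i, j)\<in>{(i, j). i \<noteq> j}. g i j)"
    by (subst sum.Sigma) (auto intro!: sum.cong)
  also have "\<dots> = (\<Sum>(i, j)\<in>{(i, j). i < j} \<union> {(i, j). j < i}. g i j)"
    by (rule sum.cong) auto
  also have "\<dots> = (\<Sum>(i, j)\<in>{(i, j). i < j}. g i j) + (\<Sum>(i, j)\<in>{(i, j). j < i}. g i j)"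
    by (rule sum.union_disjoint) auto
  also have "(\<Sum>(i, j)\<in>{(i, j). j < i}. g i j) = (\<Sum>(i, j)\<in>{(i, j). i < j}. g j i)"
    by (rule sum.reindex_bij_witness[where i = prod.swap and j = prod.swap]) auto
  also have "(\<Sum>(i, j)\<in>{(i, j). i < j}. g i j) + (\<Sum>(i, j)\<in>{(i, j). i < j}. g j i) =
      (\<Sum>(i, j)\<in>{(i, j). i < j}. g i j + g j i)"
    unfolding sum.distrib[symmetric] by (rule sum.cong) auto
  finally show ?thesis .
qed

lemma (in simple_lie_algebra) bounded_linear_complex_linear:
  fixes f :: "'g \<Rightarrow> complex"
  assumes "\<And>x y. f (x + y) = f x + f y" "\<And>c x. f (sg c x) = c * f x"
  shows "bounded_linear f"
  unfolding linear_conv_bounded_linear[symmetric]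
  by (rule linearI) (simp_all add: assms scale_of_real[symmetric] scaleR_conv_of_real)

lemma (in simple_lie_algebra) bounded_linear_scale_left: "bounded_linear (\<lambda>t. sg t x)"
  unfolding linear_conv_bounded_linear[symmetric]
  by (rule linearI) (simp_all add: scale_left_distrib scaleR_conv_of_real scale_of_real[symmetric])

lemma (in simple_lie_algebra) subspace_complex_subspace:
  assumes "subspace_of sg I"
  shows "Real_Vector_Spaces.subspace I"
  using subspace_0[OF assms] subspace_add[OF assms] subspace_scale[OF assms, of _ "of_real _"]
  by (auto simp: Real_Vector_Spaces.subspace_def scale_of_real)

section \<open>The connection form in coordinates\<close>

text \<open>For the system written as du = A u, this is the value of \<phi> on A at the point
  \<open>p\<close> in the direction \<open>h\<close>, applied to \<open>w\<close>. The component
  \<open>snd h\<close> weights the equations in z, and \<open>fst h\<close> enters as the direction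
  of the equation in \<mu>.\<close>

definition connection_coeff ::
    "('g \<Rightarrow> complex) set \<Rightarrow> ('g \<Rightarrow> complex) set \<Rightarrow> (('g \<Rightarrow> complex) \<Rightarrow> 'g) \<Rightarrow> nat \<Rightarrow> (nat \<Rightarrow> 'g) \<Rightarrow>
     ('n::finite \<Rightarrow> 'g \<Rightarrow> 't \<Rightarrow> 't::ab_group_add) \<Rightarrow> complex \<Rightarrow> ('t \<Rightarrow> complex) \<Rightarrow>
     'g \<times> (complex ^ 'n) \<Rightarrow> 'g \<times> (complex ^ 'n) \<Rightarrow> 't \<Rightarrow> complex"
  where "connection_coeff R P e r hs act \<kappa> \<phi> p h w =
    ((\<Sum>i\<in>UNIV. vec_nth (snd h) i * (\<phi> (act i (fst p) w) +
        (\<Sum>j\<in>UNIV - {i}. 1 / (vec_nth (snd p) i - vec_nth (snd p) j) * \<phi> (Omega R e r hs act i j w)))) +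
     ((\<Sum>i\<in>UNIV. vec_nth (snd p) i * \<phi> (act i (fst h) w)) +
      (\<Sum>\<alpha>\<in>P. \<alpha> (fst h) / \<alpha> (fst p) *
        \<phi> (total_action act (e (- \<alpha>)) (total_action act (e \<alpha>) w))))) / \<kappa>"

context root_decomposition_tensor_product
begin

lemma total_action_compose_linear:
  "Vector_Spaces.linear st st (\<lambda>w. total_action act x (total_action act y w))"
  using Vector_Spaces.linear_compose[OF total_action_linear total_action_linear]
  by (simp add: comp_def)

lemma connection_coeff_linear:
  assumes \<phi>: "Vector_Spaces.linear st (*) \<phi>"
  shows "Vector_Spaces.linear st (*) (connection_coeff R P e r hs act \<kappa> \<phi> p h)"
proof -
  have \<phi>_rules: "\<phi> (u + w) = \<phi> u + \<phi> w" "\<phi> (st c w) = c * \<phi> w" for u w c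
    using \<phi> by (simp_all add: Vector_Spaces.linear_iff)
  have \<Omega>: "Omega R e r hs act i j (u + w) = Omega R e r hs act i j u + Omega R e r hs act i j w"
    "Omega R e r hs act i j (st c w) = st c (Omega R e r hs act i j w)" for i j u w c
    using Omega_linear[of R r hs i j] by (simp_all add: Vector_Spaces.linear_iff)
  have T: "total_action act x (u + w) = total_action act x u + total_action act x w"
    "total_action act x (st c w) = st c (total_action act x w)" for x u w c
    using total_action_linear[of x] by (simp_all add: Vector_Spaces.linear_iff)
  show ?thesis
    unfolding Vector_Spaces.linear_iff
  proof (intro conjI allI)
    show "connection_coeff R P e r hs act \<kappa> \<phi> p h (u + w) =
        connection_coeff R P e r hs act \<kappa> \<phi> p h u + connection_coeff R P e r hs act \<kappa> \<phi> p h w" for u w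
      by (simp add: connection_coeff_def act_right \<phi>_rules \<Omega> T sum.distrib distrib_left
          add_divide_distrib)
    show "connection_coeff R P e r hs act \<kappa> \<phi> p h (st c w) =
        c * connection_coeff R P e r hs act \<kappa> \<phi> p h w" for c w
      by (simp add: connection_coeff_def act_right \<phi>_rules \<Omega> T sum_distrib_left distrib_left
          mult.left_commute)
  qed unfold_locales
qed

text \<open>The equations give the derivative along each coordinate of z and along each direction of
  \<open>H\<close>; additivity of \<open>D\<close> combines them to an arbitrary direction in
  \<open>H \<times> UNIV\<close>.\<close>

lemma is_solution_has_derivative:
  assumes sol: "is_solution sg H R P e r hs st act \<kappa> W U u" and "\<kappa> \<noteq> 0"
    and U: "openin (top_of_set (H \<times> UNIV)) U" and p: "p \<in> U"
    and \<phi>: "Vector_Spaces.linear st (*) \<phi>"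
  shows "\<exists>D. ((\<lambda>q. \<phi> (u q)) has_derivative D) (at p within U) \<and>
    (\<forall>h\<in>H \<times> UNIV. D h = connection_coeff R P e r hs act \<kappa> \<phi> p h (u p))"
proof -
  interpret \<phi>: Vector_Spaces.linear st "(*)" \<phi> by (rule \<phi>)
  obtain \<mu> z where pz: "p = (\<mu>, z)" by (cases p)
  have "\<mu> \<in> H" using openin_imp_subset[OF U] p pz by auto
  have "(\<lambda>q. \<phi> (u q)) differentiable_on U"
    using sol \<phi> by (simp add: is_solution_def vdifferentiable_on_def)
  then obtain D where D: "((\<lambda>q. \<phi> (u q)) has_derivative D) (at p within U)"
    using p by (auto simp: differentiable_on_def differentiable_def)
  interpret D: bounded_linear D by (rule has_derivative_bounded_linear[OF D])
  have eqs: "(\<forall>i. \<exists>D. has_vderiv st (\<lambda>t. u (\<mu>, z + axis i t)) D 0 \<and>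
        st \<kappa> D = act i \<mu> (u p) +
          (\<Sum>j\<in>UNIV - {i}. st (1 / (vec_nth z i - vec_nth z j)) (Omega R e r hs act i j (u p)))) \<and>
      (\<forall>\<mu>'\<in>H. \<exists>D. has_vderiv st (\<lambda>t. u (\<mu> + sg t \<mu>', z)) D 0 \<and>
        st \<kappa> D = (\<Sum>i\<in>UNIV. st (vec_nth z i) (act i \<mu>' (u p))) +
          (\<Sum>\<alpha>\<in>P. st (\<alpha> \<mu>' / \<alpha> \<mu>)
            (total_action act (e (- \<alpha>)) (total_action act (e \<alpha>) (u p)))))"
    using sol p unfolding is_solution_def pz by blast
  \<comment> \<open>\<open>D\<close> is only known to be real linear, so every complex
    \<open>t\<close> is treated at once.\<close>
  have dir_z: "D (0, axis i t) = t * (\<phi> (act i \<mu> (u p)) +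
      (\<Sum>j\<in>UNIV - {i}. 1 / (vec_nth z i - vec_nth z j) * \<phi> (Omega R e r hs act i j (u p)))) / \<kappa>" for i t
  proof -
    obtain X where X: "has_vderiv st (\<lambda>t. u (\<mu>, z + axis i t)) X 0"
        "st \<kappa> X = act i \<mu> (u p) +
          (\<Sum>j\<in>UNIV - {i}. st (1 / (vec_nth z i - vec_nth z j)) (Omega R e r hs act i j (u p)))"
      using eqs by blast
    have "D (0, axis i t) = \<phi> X * t"
    proof (rule has_derivative_along_curve[where c = "\<lambda>t. (\<mu>, z + axis i t)" and f' = D
          and c' = "\<lambda>t. (0, axis i t)"])
      show "((\<lambda>q. \<phi> (u q)) has_derivative D) (at (\<mu>, z + axis i 0) within U)"
        using D by (simp add: pz axis_eq_0_iff[THEN iffD2])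
      show "((\<lambda>t. (\<mu>, z + axis i t)) has_derivative (\<lambda>t. (0, axis i t))) (at 0)"
        by (intro has_derivative_Pair has_derivative_const
            has_derivative_add[OF has_derivative_const, where g' = "axis i", simplified]
            bounded_linear_imp_has_derivative bounded_linear_axis)
      show "((\<lambda>t. \<phi> (u (\<mu>, z + axis i t))) has_field_derivative \<phi> X) (at 0)"
        using X(1) \<phi> by (simp add: has_vderiv_def)
    qed (use U p pz \<open>\<mu> \<in> H\<close> in \<open>auto simp: axis_eq_0_iff[THEN iffD2]\<close>)
    moreover have "\<phi> X = (\<phi> (act i \<mu> (u p)) +
        (\<Sum>j\<in>UNIV - {i}. 1 / (vec_nth z i - vec_nth z j) * \<phi> (Omega R e r hs act i j (u p)))) / \<kappa>"
      unfolding nonzero_eq_divide_eq[OF \<open>\<kappa> \<noteq> 0\<close>] mult.commute[of _ \<kappa>] \<phi>.scale[symmetric] X(2)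
      by (simp only: \<phi>.add \<phi>.sum)
    ultimately show ?thesis by simp
  qed
  have dir_\<mu>: "D (\<mu>', 0) = ((\<Sum>i\<in>UNIV. vec_nth z i * \<phi> (act i \<mu>' (u p))) +
      (\<Sum>\<alpha>\<in>P. \<alpha> \<mu>' / \<alpha> \<mu> * \<phi> (total_action act (e (- \<alpha>)) (total_action act (e \<alpha>) (u p))))) / \<kappa>"
    if "\<mu>' \<in> H" for \<mu>'
  proof -
    obtain X where X: "has_vderiv st (\<lambda>t. u (\<mu> + sg t \<mu>', z)) X 0"
        "st \<kappa> X = (\<Sum>i\<in>UNIV. st (vec_nth z i) (act i \<mu>' (u p))) +
          (\<Sum>\<alpha>\<in>P. st (\<alpha> \<mu>' / \<alpha> \<mu>)
            (total_action act (e (- \<alpha>)) (total_action act (e \<alpha>) (u p))))"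
      using eqs \<open>\<mu>' \<in> H\<close> by blast
    \<comment> \<open>Complex multiples of \<open>\<mu>'\<close> are themselves directions in
      \<open>H\<close>, so the parameter 1 suffices here.\<close>
    have "D (sg 1 \<mu>', 0) = \<phi> X * 1"
    proof (rule has_derivative_along_curve[where c = "\<lambda>t. (\<mu> + sg t \<mu>', z)" and f' = D
          and c' = "\<lambda>t. (sg t \<mu>', 0)"])
      show "((\<lambda>q. \<phi> (u q)) has_derivative D) (at (\<mu> + sg 0 \<mu>', z) within U)"
        using D by (simp add: pz)
      show "((\<lambda>t. (\<mu> + sg t \<mu>', z)) has_derivative (\<lambda>t. (sg t \<mu>', 0))) (at 0)"
        by (intro has_derivative_Pair has_derivative_const
            has_derivative_add[OF has_derivative_const, where g' = "\<lambda>t. sg t \<mu>'", simplified]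
            bounded_linear_imp_has_derivative bounded_linear_scale_left)
      show "((\<lambda>t. \<phi> (u (\<mu> + sg t \<mu>', z))) has_field_derivative \<phi> X) (at 0)"
        using X(1) \<phi> by (simp add: has_vderiv_def)
      show "(\<mu> + sg t \<mu>', z) \<in> H \<times> UNIV" for t
        using \<open>\<mu> \<in> H\<close> \<open>\<mu>' \<in> H\<close> subspace_H by (simp add: subspace_add subspace_scale)
    qed (use U p pz in auto)
    moreover have "\<phi> X = ((\<Sum>i\<in>UNIV. vec_nth z i * \<phi> (act i \<mu>' (u p))) +
      (\<Sum>\<alpha>\<in>P. \<alpha> \<mu>' / \<alpha> \<mu> * \<phi> (total_action act (e (- \<alpha>)) (total_action act (e \<alpha>) (u p))))) / \<kappa>"
      unfolding nonzero_eq_divide_eq[OF \<open>\<kappa> \<noteq> 0\<close>] mult.commute[of _ \<kappa>] \<phi>.scale[symmetric] X(2)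
      by (simp only: \<phi>.add \<phi>.sum)
    ultimately show ?thesis by simp
  qed
  have "D h = connection_coeff R P e r hs act \<kappa> \<phi> p h (u p)" if "h \<in> H \<times> UNIV" for h
  proof -
    obtain \<mu>' z' where h: "h = (\<mu>', z')" by (cases h)
    have "D h = D ((\<mu>', 0) + (\<Sum>i\<in>UNIV. (0, axis i (vec_nth z' i))))"
      unfolding h by (subst prod_sum_axis) (rule refl)
    also have "\<dots> = (\<Sum>i\<in>UNIV. D (0, axis i (vec_nth z' i))) + D (\<mu>', 0)"
      by (simp only: D.add D.sum add.commute)
    finally show ?thesis
      using that h by (simp only: dir_z dir_\<mu> connection_coeff_def pz fst_conv snd_conv
          mem_Sigma_iff add_divide_distrib sum_divide_distrib)
  qed
  with D show ?thesis by blast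
qed

text \<open>Genericity keeps all denominators away from 0 on \<open>U\<close>; in the numerators
  \<open>h\<close> and \<open>w\<close> are fixed.\<close>

lemma continuous_on_connection_coeff:
  assumes U: "U \<subseteq> generic_points H (roots sg br H)" and P: "P \<subseteq> roots sg br H"
    and \<phi>: "Vector_Spaces.linear st (*) \<phi>"
  shows "continuous_on U (\<lambda>p. connection_coeff R P e r hs act \<kappa> \<phi> p h w)"
proof -
  have \<phi>_rules: "\<phi> (u + w) = \<phi> u + \<phi> w" "\<phi> (st c w) = c * \<phi> w" for u w c
    using \<phi> by (simp_all add: Vector_Spaces.linear_iff)
  have "bounded_linear (\<lambda>\<mu>. \<phi> (act i \<mu> w))" for i
    by (rule bounded_linear_complex_linear) (simp_all add: act_add_left act_scale_left \<phi>_rules)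
  then have act: "continuous_on U (\<lambda>p. \<phi> (act i (fst p) w))" for i
    by (rule bounded_linear.continuous_on[where f = "\<lambda>\<mu>. \<phi> (act i \<mu> w)"]) (rule continuous_on_fst[OF continuous_on_id])
  \<comment> \<open>A root extended by 0 is discontinuous on the whole algebra; this linear function
    agrees with it on \<open>H\<close>.\<close>
  have bl: "bounded_linear (\<lambda>\<mu>. form (br \<mu> (e \<alpha>)) (e (- \<alpha>)))" for \<alpha>
    by (rule bounded_linear_complex_linear) (simp_all add: br_add_left br_scale_left form_left)
  have root: "continuous_on U (\<lambda>p. \<alpha> (fst p))" if "\<alpha> \<in> P" for \<alpha>
  proof -
    have "continuous_on U (\<lambda>p. form (br (fst p) (e \<alpha>)) (e (- \<alpha>)))"
      by (rule bounded_linear.continuous_on[OF bl]) (rule continuous_on_fst[OF continuous_on_id])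
    moreover have "form (br (fst p) (e \<alpha>)) (e (- \<alpha>)) = \<alpha> (fst p)" if "p \<in> U" for p
    proof (rule root_eq_form[symmetric])
      show "\<alpha> \<in> roots sg br H" using P \<open>\<alpha> \<in> P\<close> by blast
      show "fst p \<in> H" using that U by (auto simp: generic_points_def)
    qed
    ultimately show ?thesis
      by (rule continuous_on_eq[where f = "\<lambda>p. form (br (fst p) (e \<alpha>)) (e (- \<alpha>))"])
  qed
  have z: "continuous_on U (\<lambda>p. vec_nth (snd p) i)" for i
    by (rule bounded_linear.continuous_on[OF bounded_linear_vec_nth continuous_on_snd[OF continuous_on_id]])
  have "\<forall>p\<in>U. vec_nth (snd p) i - vec_nth (snd p) j \<noteq> 0" if "j \<in> UNIV - {i}" for i j
    using that U by (auto simp: generic_points_def)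
  moreover have "\<forall>p\<in>U. \<alpha> (fst p) \<noteq> 0" if "\<alpha> \<in> P" for \<alpha>
  proof
    fix p assume "p \<in> U"
    then have "p \<in> generic_points H (roots sg br H)" using U by blast
    moreover have "\<alpha> \<in> roots sg br H" using P that by blast
    ultimately show "\<alpha> (fst p) \<noteq> 0" by (auto simp: generic_points_def)
  qed
  ultimately show ?thesis
    unfolding connection_coeff_def divide_inverse[of _ \<kappa>]
    by (intro continuous_on_add continuous_on_mult continuous_on_sum continuous_on_divide
        continuous_on_diff continuous_on_const act root z)
qed

end

section \<open>The logarithm of the claimed product and its differential\<close>

text \<open>With \<delta>, \<epsilon> and \<open>t\<close> the traces, the prescribed value of
  \<open>D\<close> is the trace of the connection form. The product rule applied to
  \<open>z i * t i \<mu>\<close> yields both the terms of \<mu> in the z-equations and the terms of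
  z in the \<mu>-equation.\<close>

lemma (in root_decomposition) potential_has_derivative:
  fixes t :: "'n::{finite,linorder} \<Rightarrow> 'g \<Rightarrow> complex"
  assumes t: "\<And>i. bounded_linear (t i)" and p: "p \<in> U"
    and U: "U \<subseteq> generic_points H (roots sg br H)" and P: "P \<subseteq> roots sg br H"
    and logroot: "\<And>\<alpha>. \<alpha> \<in> P \<Longrightarrow> log_branch_on U (\<lambda>(\<mu>, z). \<alpha> \<mu>) (logroot \<alpha>)"
    and logdiff: "\<And>i j. i < j \<Longrightarrow> log_branch_on U (\<lambda>(\<mu>, z). vec_nth z i - vec_nth z j) (logdiff i j)"
    and \<epsilon>: "\<And>i j. i \<noteq> j \<Longrightarrow> \<epsilon> i j = \<epsilon> j i"
  shows "\<exists>D. ((\<lambda>p. (\<Sum>i\<in>UNIV. vec_nth (snd p) i / \<kappa> * t i (fst p)) +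
        (\<Sum>\<alpha>\<in>P. \<delta> \<alpha> / \<kappa> * logroot \<alpha> p) +
        (\<Sum>(i, j)\<in>{(i, j). i < j}. \<epsilon> i j / \<kappa> * logdiff i j p)) has_derivative D) (at p within U) \<and>
      (\<forall>h\<in>H \<times> UNIV. D h =
        ((\<Sum>i\<in>UNIV. vec_nth (snd h) i * (t i (fst p) +
          (\<Sum>j\<in>UNIV - {i}. 1 / (vec_nth (snd p) i - vec_nth (snd p) j) * \<epsilon> i j))) +
        ((\<Sum>i\<in>UNIV. vec_nth (snd p) i * t i (fst h)) +
          (\<Sum>\<alpha>\<in>P. \<alpha> (fst h) / \<alpha> (fst p) * \<delta> \<alpha>))) / \<kappa>)"
proof -
  let ?z = "vec_nth (snd p)"
  let ?f = "\<lambda>\<alpha> h. form (br (fst h) (e \<alpha>)) (e (- \<alpha>))"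
  have z: "((\<lambda>p. vec_nth (snd p) i) has_derivative (\<lambda>h. vec_nth (snd h) i)) (at p within U)" for i
    by (rule bounded_linear_imp_has_derivative)
      (rule bounded_linear_compose[OF bounded_linear_vec_nth bounded_linear_snd])
  have t': "((\<lambda>p. t i (fst p)) has_derivative (\<lambda>h. t i (fst h))) (at p within U)" for i
    by (rule bounded_linear_imp_has_derivative) (rule bounded_linear_compose[OF t bounded_linear_fst])
  have root: "(logroot \<alpha> has_derivative (\<lambda>h. ?f \<alpha> h / \<alpha> (fst p))) (at p within U)" if "\<alpha> \<in> P" for \<alpha>
  proof -
    have "bounded_linear (\<lambda>\<mu>. form (br \<mu> (e \<alpha>)) (e (- \<alpha>)))"
      by (rule bounded_linear_complex_linear) (simp_all add: br_add_left br_scale_left form_left)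
    then have deriv: "(?f \<alpha> has_derivative ?f \<alpha>) (at p within U)"
      by (rule bounded_linear_imp_has_derivative[OF bounded_linear_compose[OF _ bounded_linear_fst]])
    have eq: "(case q of (\<mu>, z) \<Rightarrow> \<alpha> \<mu>) = ?f \<alpha> q" if "q \<in> U" for q
    proof -
      have "\<alpha> (fst q) = ?f \<alpha> q"
        by (rule root_eq_form)
          (use that U P \<open>\<alpha> \<in> P\<close> in \<open>auto simp: generic_points_def\<close>)
      then show ?thesis by (simp add: case_prod_beta)
    qed
    have "((\<lambda>(\<mu>, z). \<alpha> \<mu>) has_derivative ?f \<alpha>) (at p within U)"
      by (rule has_derivative_transform[OF p eq deriv])
    from has_derivative_log_branch[OF logroot[OF that] p this]
    show ?thesis by (simp add: case_prod_beta)
  qed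
  have diff: "(logdiff i j has_derivative (\<lambda>h. (vec_nth (snd h) i - vec_nth (snd h) j) / (?z i - ?z j)))
      (at p within U)" if "i < j" for i j
  proof -
    have "((\<lambda>(\<mu>, z). vec_nth z i - vec_nth z j) has_derivative
        (\<lambda>h. vec_nth (snd h) i - vec_nth (snd h) j)) (at p within U)"
      unfolding case_prod_beta by (rule has_derivative_diff[OF z z])
    from has_derivative_log_branch[OF logdiff[OF that] p this]
    show ?thesis by (simp add: case_prod_beta)
  qed
  define D where "D h = (\<Sum>i\<in>UNIV. ?z i / \<kappa> * t i (fst h) + vec_nth (snd h) i / \<kappa> * t i (fst p)) +
      (\<Sum>\<alpha>\<in>P. \<delta> \<alpha> / \<kappa> * (?f \<alpha> h / \<alpha> (fst p))) +
      (\<Sum>(i, j)\<in>{(i, j). i < j}. \<epsilon> i j / \<kappa> * ((vec_nth (snd h) i - vec_nth (snd h) j) / (?z i - ?z j)))" for h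
  have "((\<lambda>p. (\<Sum>i\<in>UNIV. vec_nth (snd p) i / \<kappa> * t i (fst p)) +
        (\<Sum>\<alpha>\<in>P. \<delta> \<alpha> / \<kappa> * logroot \<alpha> p) +
        (\<Sum>(i, j)\<in>{(i, j). i < j}. \<epsilon> i j / \<kappa> * logdiff i j p)) has_derivative D) (at p within U)"
    unfolding D_def
  proof (intro has_derivative_add has_derivative_sum)
    show "((\<lambda>p. vec_nth (snd p) i / \<kappa> * t i (fst p)) has_derivative
        (\<lambda>h. ?z i / \<kappa> * t i (fst h) + vec_nth (snd h) i / \<kappa> * t i (fst p))) (at p within U)" for i
      by (intro has_derivative_mult t' bounded_linear.has_derivative[OF bounded_linear_divide z])
    show "((\<lambda>p. \<delta> \<alpha> / \<kappa> * logroot \<alpha> p) has_derivative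
        (\<lambda>h. \<delta> \<alpha> / \<kappa> * (?f \<alpha> h / \<alpha> (fst p)))) (at p within U)" if "\<alpha> \<in> P" for \<alpha>
      by (intro has_derivative_mult_right root that)
    show "((\<lambda>p. case x of (i, j) \<Rightarrow> \<epsilon> i j / \<kappa> * logdiff i j p) has_derivative
        (\<lambda>h. case x of (i, j) \<Rightarrow> \<epsilon> i j / \<kappa> *
          ((vec_nth (snd h) i - vec_nth (snd h) j) / (?z i - ?z j)))) (at p within U)"
      if "x \<in> {(i, j). i < j}" for x
      using that by (cases x) (simp only: prod.case mem_Collect_eq, intro has_derivative_mult_right diff)
  qed
  moreover have "D h =
        ((\<Sum>i\<in>UNIV. vec_nth (snd h) i * (t i (fst p) +
          (\<Sum>j\<in>UNIV - {i}. 1 / (?z i - ?z j) * \<epsilon> i j))) +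
        ((\<Sum>i\<in>UNIV. ?z i * t i (fst h)) +
          (\<Sum>\<alpha>\<in>P. \<alpha> (fst h) / \<alpha> (fst p) * \<delta> \<alpha>))) / \<kappa>" if h: "h \<in> H \<times> UNIV" for h
  proof -
    let ?w = "vec_nth (snd h)"
    \<comment> \<open>Each pair occurs twice with opposite denominators; symmetry of \<epsilon>
      turns the two terms into the differential of the logarithm of z_i - z_j.\<close>
    have "(\<Sum>i\<in>UNIV. \<Sum>j\<in>UNIV - {i}. ?w i / (?z i - ?z j) * \<epsilon> i j) =
        (\<Sum>(i, j)\<in>{(i, j). i < j}. ?w i / (?z i - ?z j) * \<epsilon> i j + ?w j / (?z j - ?z i) * \<epsilon> j i)"
      by (rule sum_off_diagonal)
    also have "\<dots> = (\<Sum>(i, j)\<in>{(i, j). i < j}. \<epsilon> i j * ((?w i - ?w j) / (?z i - ?z j)))"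
    proof (intro sum.cong refl, clarify)
      fix i j :: 'n assume "i < j"
      then have "\<epsilon> j i = \<epsilon> i j" using \<epsilon>[of j i] by simp
      moreover have "?w j / (?z j - ?z i) = - (?w j / (?z i - ?z j))"
        by (simp add: minus_divide_right)
      ultimately show "?w i / (?z i - ?z j) * \<epsilon> i j + ?w j / (?z j - ?z i) * \<epsilon> j i =
          \<epsilon> i j * ((?w i - ?w j) / (?z i - ?z j))"
        by (simp only: diff_divide_distrib) (simp add: algebra_simps)
    qed
    finally have diffs: "(\<Sum>i\<in>UNIV. \<Sum>j\<in>UNIV - {i}. ?w i / (?z i - ?z j) * \<epsilon> i j) = \<dots>" .
    have roots: "?f \<alpha> h = \<alpha> (fst h)" if "\<alpha> \<in> P" for \<alpha>
      by (rule root_eq_form[symmetric]) (use that P h in auto)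
    have "D h = ((\<Sum>i\<in>UNIV. ?z i * t i (fst h)) + (\<Sum>i\<in>UNIV. ?w i * t i (fst p)) +
        (\<Sum>\<alpha>\<in>P. \<alpha> (fst h) / \<alpha> (fst p) * \<delta> \<alpha>) +
        (\<Sum>(i, j)\<in>{(i, j). i < j}. \<epsilon> i j * ((?w i - ?w j) / (?z i - ?z j)))) / \<kappa>"
      by (simp add: D_def roots sum.distrib add_divide_distrib sum_divide_distrib case_prod_beta mult_ac)
    then show ?thesis
      unfolding diffs[symmetric] by (simp add: distrib_left sum.distrib sum_distrib_left add_ac)
  qed
  ultimately show ?thesis by blast
qed

text \<open>The complex powers are taken with respect to the given branches. On the connected set
  \<open>U\<close> two branches differ by a constant multiple of 2 pi i, so another choice only
  rescales \<open>C\<close>.\<close>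

theorem corollary3p3:
  fixes sg :: "complex \<Rightarrow> 'g \<Rightarrow> 'g::euclidean_space"
    and br :: "'g \<Rightarrow> 'g \<Rightarrow> 'g"
    and form :: "'g \<Rightarrow> 'g \<Rightarrow> complex"
    and H :: "'g set"
    and e :: "('g \<Rightarrow> complex) \<Rightarrow> 'g"
    and r :: nat
    and a :: "nat \<Rightarrow> 'g \<Rightarrow> complex"
    and hs :: "nat \<Rightarrow> 'g"
    and sv :: "complex \<Rightarrow> 'v \<Rightarrow> 'v::ab_group_add"
    and V :: "'n::{finite,linorder} \<Rightarrow> 'v set"
    and \<rho> :: "'n \<Rightarrow> 'g \<Rightarrow> 'v \<Rightarrow> 'v"
    and \<Lambda> :: "'n \<Rightarrow> 'g \<Rightarrow> complex"
    and st :: "complex \<Rightarrow> 't \<Rightarrow> 't::ab_group_add"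
    and \<tau> :: "('n \<Rightarrow> 'v) \<Rightarrow> 't"
    and act :: "'n \<Rightarrow> 'g \<Rightarrow> 't \<Rightarrow> 't"
    and \<kappa> :: complex
    and m :: "nat \<Rightarrow> nat"
    and d :: nat
    and v :: "nat \<Rightarrow> 't"
    and U :: "('g \<times> (complex ^ 'n::{finite,linorder})) set"
    and p0 :: "'g \<times> (complex ^ 'n::{finite,linorder})"
    and u :: "nat \<Rightarrow> 'g \<times> (complex ^ 'n::{finite,linorder}) \<Rightarrow> 't"
    and uc :: "nat \<Rightarrow> nat \<Rightarrow> 'g \<times> (complex ^ 'n::{finite,linorder}) \<Rightarrow> complex"
    and logroot :: "('g \<Rightarrow> complex) \<Rightarrow> 'g \<times> (complex ^ 'n::{finite,linorder}) \<Rightarrow> complex"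
    and logdiff :: "'n \<Rightarrow> 'n \<Rightarrow> 'g \<times> (complex ^ 'n::{finite,linorder}) \<Rightarrow> complex"
    and R P :: "('g \<Rightarrow> complex) set"
    and W :: "'t set"
    and \<delta> :: "('g \<Rightarrow> complex) \<Rightarrow> complex"
    and \<epsilon> :: "'n \<Rightarrow> 'n \<Rightarrow> complex"
  assumes "root_decomposition sg br form H e"
    and "R = roots sg br H"
    and "simple_roots R r a"
    and "P = positive_roots R r a"
    and "orthonormal_basis_of sg form H r hs"
    and "\<And>i. highest_weight_module sg br H P e sv (V i) (\<rho> i) (\<Lambda> i)"
    and "tensor_product sv V st \<tau>"
    and "factor_action st V \<rho> \<tau> act"
    and "\<kappa> \<noteq> 0"
    and "W = weight_space st H act (\<lambda>h. (\<Sum>j\<in>UNIV. \<Lambda> j h) - (\<Sum>i<r. of_nat (m i) * a i h))"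
    and "basis_of st W d v"
    and "p0 \<in> U" and "connected U" and "openin (top_of_set (H \<times> UNIV)) U"
    and "U \<subseteq> generic_points H R"
    and "basis_of_solutions st U (is_solution sg H R P e r hs st act \<kappa> W U) d u"
    and "\<And>i p. i < d \<Longrightarrow> p \<in> U \<Longrightarrow> u i p = (\<Sum>j<d. st (uc i j p) (v j))"
    and "\<And>\<alpha>. \<delta> \<alpha> = trace_on st W (\<lambda>w. total_action act (e (- \<alpha>)) (total_action act (e \<alpha>) w))"
    and "\<And>i j. \<epsilon> i j = trace_on st W (Omega R e r hs act i j)"
    and "\<And>\<alpha>. \<alpha> \<in> P \<Longrightarrow> log_branch_on U (\<lambda>(\<mu>, z). \<alpha> \<mu>) (logroot \<alpha>)"
    and "\<And>i j. i < j \<Longrightarrow> log_branch_on U (\<lambda>(\<mu>, z). vec_nth z i - vec_nth z j) (logdiff i j)"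
  shows "\<exists>C::complex. C \<noteq> 0 \<and> (\<forall>(\<mu>, z)\<in>U.
    Determinant.det (Matrix.mat d d (\<lambda>(i, j). uc i j (\<mu>, z))) =
      C * exp (\<Sum>i\<in>UNIV. vec_nth z i / \<kappa> * trace_on st W (act i \<mu>))
        * (\<Prod>\<alpha>\<in>P. exp (\<delta> \<alpha> / \<kappa> * logroot \<alpha> (\<mu>, z)))
        * (\<Prod>(i, j)\<in>{(i, j). i < j}. exp (\<epsilon> i j / \<kappa> * logdiff i j (\<mu>, z))))"
proof -
  interpret root_decomposition sg br form H e by (rule assms(1))
  note R = assms(2) and P_def = assms(4) and orth = assms(5) and \<kappa> = assms(9) and W = assms(10)
    and v = assms(11) and p0 = assms(12) and conn = assms(13) and op = assms(14) and gen = assms(15)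
    and basis = assms(16) and uc = assms(17) and \<delta> = assms(18) and \<epsilon> = assms(19)
  interpret lie_module_tensor_product sg br sv V \<rho> st \<tau> act
    using assms(6-8) by unfold_locales (auto simp: highest_weight_module_def)
  interpret root_decomposition_tensor_product sg br form H e sv V \<rho> st \<tau> act ..
  have PR: "P \<subseteq> roots sg br H" unfolding P_def R positive_roots_def by blast
  have hs: "hs s \<in> H" if "s < r" for s
    using orth that span_base[of "hs s" "hs ` {..<r}"]
    by (auto simp: orthonormal_basis_of_def basis_of_def)
  obtain \<phi> where \<phi>: "\<And>j. Vector_Spaces.linear st (*) (\<phi> j)"
      "\<And>j k. j < d \<Longrightarrow> k < d \<Longrightarrow> \<phi> j (v k) = (if j = k then 1 else 0)"
      "\<And>w. w \<in> W \<Longrightarrow> w = (\<Sum>k<d. st (\<phi> k w) (v k))"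
    by (rule basis_coordinates[OF T.vector_space_axioms v]) blast
  have \<phi>_rules: "\<phi> j (x + y) = \<phi> j x + \<phi> j y" "\<phi> j (st c x) = c * \<phi> j x" for j x y c
    using \<phi>(1)[of j] by (simp_all add: Vector_Spaces.linear_iff)
  have \<phi>_sum: "\<phi> j (\<Sum>x\<in>X. g x) = (\<Sum>x\<in>X. \<phi> j (g x))" for j g and X :: "nat set"
  proof -
    interpret \<phi>: Vector_Spaces.linear st "(*)" "\<phi> j" by (rule \<phi>(1))
    show ?thesis by (rule \<phi>.sum)
  qed
  note trace = trace_on_eq_sum_coordinates[OF T.vector_space_axioms v _ _ \<phi>(1) \<phi>(3)]
  \<comment> \<open>For \<mu> outside \<open>H\<close> the operator need not preserve
    \<open>W\<close>. The coordinate sum is linear in \<mu> on the whole algebra and equals the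
    trace on \<open>H\<close>.\<close>
  define t where "t i \<mu> = (\<Sum>k<d. \<phi> k (act i \<mu> (v k)))" for i \<mu>
  have trace_act: "trace_on st W (act i \<mu>) = t i \<mu>" if "\<mu> \<in> H" for i \<mu>
    unfolding t_def by (rule trace) (use that W in \<open>simp_all add: act_linear cartan_act_weight_space\<close>)
  have \<delta>_eq: "\<delta> \<alpha> = (\<Sum>k<d. \<phi> k (total_action act (e (- \<alpha>)) (total_action act (e \<alpha>) (v k))))"
    if "\<alpha> \<in> P" for \<alpha>
    unfolding \<delta>
  proof (rule trace)
    show "total_action act (e (- \<alpha>)) (total_action act (e \<alpha>) w) \<in> W" if "w \<in> W" for w
      using that PR \<open>\<alpha> \<in> P\<close> unfolding W by (intro root_total_action_weight_space) auto
  qed (rule total_action_compose_linear)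
  have \<epsilon>_eq: "\<epsilon> i j = (\<Sum>k<d. \<phi> k (Omega R e r hs act i j (v k)))" for i j
    unfolding \<epsilon>
  proof (rule trace)
    show "Omega R e r hs act i j w \<in> W" if "w \<in> W" for w
      using that unfolding W R by (intro Omega_weight_space hs)
  qed (rule Omega_linear)
  have bl: "bounded_linear (t i)" for i
    unfolding t_def
    by (intro bounded_linear_sum bounded_linear_complex_linear)
      (simp_all add: act_add_left act_scale_left \<phi>_rules)
  define Y where "Y i j p = \<phi> j (u i p)" for i j p
  \<comment> \<open>The \<open>j\<close>-th coordinate of the image of \<open>v k\<close>, indexed
    so that it multiplies rows of coordinates from the right.\<close>
  define A where "A p h k j = connection_coeff R P e r hs act \<kappa> (\<phi> j) p h (v k)" for p h k j
  define l where "l p = (\<Sum>i\<in>UNIV. vec_nth (snd p) i / \<kappa> * t i (fst p)) +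
        (\<Sum>\<alpha>\<in>P. \<delta> \<alpha> / \<kappa> * logroot \<alpha> p) +
        (\<Sum>(i, j)\<in>{(i, j). i < j}. \<epsilon> i j / \<kappa> * logdiff i j p)" for p
  have sol: "is_solution sg H R P e r hs st act \<kappa> W U (u i)" if "i < d" for i
    using basis that by (simp add: basis_of_solutions_def)
  have uW: "u i p \<in> W" if "i < d" "p \<in> U" for i p
  proof -
    obtain \<mu> z where "p = (\<mu>, z)" by (cases p)
    with sol[OF that(1)] that(2) show ?thesis unfolding is_solution_def by blast
  qed
  have "\<exists>C. C \<noteq> 0 \<and> (\<forall>p\<in>U. Determinant.det (Matrix.mat d d (\<lambda>(i, j). Y i j p)) = C * exp (l p))"
  proof (rule liouville_formula[where E = "H \<times> UNIV" and A = A])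
    show "Real_Vector_Spaces.subspace (H \<times> (UNIV :: (complex ^ 'n::{finite,linorder}) set))"
      by (rule subspace_Times[OF subspace_complex_subspace[OF subspace_H] Real_Vector_Spaces.subspace_UNIV])
    show "U \<noteq> {}" using p0 by blast
  next
    fix p i j assume p: "p \<in> U" and ij: "i < d" "j < d"
    interpret conn: Vector_Spaces.linear st "(*)" "connection_coeff R P e r hs act \<kappa> (\<phi> j) p h" for h
      by (rule connection_coeff_linear[OF \<phi>(1)])
    have "connection_coeff R P e r hs act \<kappa> (\<phi> j) p h (u i p) = (\<Sum>k<d. Y i k p * A p h k j)" for h
      by (subst \<phi>(3)[OF uW[OF ij(1) p]]) (simp add: conn.sum conn.scale Y_def A_def)
    then show "\<exists>D. (Y i j has_derivative D) (at p within U) \<and>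
        (\<forall>h\<in>H \<times> UNIV. D h = (\<Sum>k<d. Y i k p * A p h k j))"
      using is_solution_has_derivative[OF sol[OF ij(1)] \<kappa> op p \<phi>(1)[of j]] unfolding Y_def by simp
  next
    fix h k j
    show "continuous_on U (\<lambda>p. A p h k j)"
      unfolding A_def using gen PR \<phi>(1) unfolding R by (rule continuous_on_connection_coeff)
  next
    fix c assume c: "\<And>p j. p \<in> U \<Longrightarrow> j < d \<Longrightarrow> (\<Sum>i<d. c i * Y i j p) = 0"
    \<comment> \<open>The combination lies in \<open>W\<close>, so it vanishes once all its
      coordinates do.\<close>
    have "(\<Sum>i<d. st (c i) (u i p)) = 0" if p: "p \<in> U" for p
    proof -
      let ?w = "\<Sum>i<d. st (c i) (u i p)"
      have "?w \<in> W"
        using uW p unfolding W by (intro T.subspace_sum T.subspace_scale subspace_weight_space) auto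
      then have "?w = (\<Sum>k<d. st (\<phi> k ?w) (v k))" by (rule \<phi>(3))
      also have "\<dots> = (\<Sum>k<d. st 0 (v k))"
        using c[OF p] by (intro sum.cong refl) (simp add: \<phi>_sum \<phi>_rules Y_def)
      finally show ?thesis by simp
    qed
    then show "\<forall>i<d. c i = 0" using basis by (simp add: basis_of_solutions_def)
  next
    fix p assume p: "p \<in> U"
    have sym: "\<epsilon> i j = \<epsilon> j i" if "i \<noteq> j" for i j
      using Omega_commute[OF that, of r hs] by (simp add: \<epsilon> R)
    have "(\<Sum>k<d. A p h k k) =
        ((\<Sum>i\<in>UNIV. vec_nth (snd h) i * (t i (fst p) +
          (\<Sum>j\<in>UNIV - {i}. 1 / (vec_nth (snd p) i - vec_nth (snd p) j) * \<epsilon> i j))) +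
        ((\<Sum>i\<in>UNIV. vec_nth (snd p) i * t i (fst h)) +
          (\<Sum>\<alpha>\<in>P. \<alpha> (fst h) / \<alpha> (fst p) * \<delta> \<alpha>))) / \<kappa>" for h
    proof -
      have 1: "(\<Sum>k<d. \<Sum>i\<in>UNIV. vec_nth (snd h) i * (\<phi> k (act i (fst p) (v k)) +
          (\<Sum>j\<in>UNIV - {i}. 1 / (vec_nth (snd p) i - vec_nth (snd p) j) *
            \<phi> k (Omega R e r hs act i j (v k))))) =
        (\<Sum>i\<in>UNIV. vec_nth (snd h) i * (t i (fst p) +
          (\<Sum>j\<in>UNIV - {i}. 1 / (vec_nth (snd p) i - vec_nth (snd p) j) * \<epsilon> i j)))"
      proof (subst sum.swap, intro sum.cong refl)
        fix i
        have "(\<Sum>k<d. \<Sum>j\<in>UNIV - {i}. 1 / (vec_nth (snd p) i - vec_nth (snd p) j) *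
              \<phi> k (Omega R e r hs act i j (v k))) =
            (\<Sum>j\<in>UNIV - {i}. 1 / (vec_nth (snd p) i - vec_nth (snd p) j) * \<epsilon> i j)"
          unfolding \<epsilon>_eq sum_distrib_left by (rule sum.swap)
        then show "(\<Sum>k<d. vec_nth (snd h) i * (\<phi> k (act i (fst p) (v k)) +
            (\<Sum>j\<in>UNIV - {i}. 1 / (vec_nth (snd p) i - vec_nth (snd p) j) *
              \<phi> k (Omega R e r hs act i j (v k))))) =
          vec_nth (snd h) i * (t i (fst p) +
            (\<Sum>j\<in>UNIV - {i}. 1 / (vec_nth (snd p) i - vec_nth (snd p) j) * \<epsilon> i j))"
          unfolding t_def by (simp only: sum_distrib_left[symmetric] sum.distrib)
      qed
      have 2: "(\<Sum>k<d. \<Sum>i\<in>UNIV. vec_nth (snd p) i * \<phi> k (act i (fst h) (v k))) =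
          (\<Sum>i\<in>UNIV. vec_nth (snd p) i * t i (fst h))"
        unfolding t_def sum_distrib_left by (rule sum.swap)
      have 3: "(\<Sum>k<d. \<Sum>\<alpha>\<in>P. \<alpha> (fst h) / \<alpha> (fst p) *
            \<phi> k (total_action act (e (- \<alpha>)) (total_action act (e \<alpha>) (v k)))) =
          (\<Sum>\<alpha>\<in>P. \<alpha> (fst h) / \<alpha> (fst p) * \<delta> \<alpha>)"
        by (subst sum.swap) (simp add: \<delta>_eq sum_distrib_left)
      show ?thesis
        unfolding A_def connection_coeff_def sum_divide_distrib[symmetric] sum.distrib 1 2 3 ..
    qed
    note tr = this
    show "\<exists>D. (l has_derivative D) (at p within U) \<and> (\<forall>h\<in>H \<times> UNIV. D h = (\<Sum>k<d. A p h k k))"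
      unfolding tr l_def
      by (rule potential_has_derivative)
        (rule bl p gen[unfolded R] PR assms(20,21) sym; assumption)+
  qed (rule op conn)+
  then obtain C where C: "C \<noteq> 0"
      "\<And>p. p \<in> U \<Longrightarrow> Determinant.det (Matrix.mat d d (\<lambda>(i, j). Y i j p)) = C * exp (l p)"
    by blast
  have "Determinant.det (Matrix.mat d d (\<lambda>(i, j). uc i j (\<mu>, z))) =
      C * exp (\<Sum>i\<in>UNIV. vec_nth z i / \<kappa> * trace_on st W (act i \<mu>))
        * (\<Prod>\<alpha>\<in>P. exp (\<delta> \<alpha> / \<kappa> * logroot \<alpha> (\<mu>, z)))
        * (\<Prod>(i, j)\<in>{(i, j). i < j}. exp (\<epsilon> i j / \<kappa> * logdiff i j (\<mu>, z)))"
    if p: "(\<mu>, z) \<in> U" for \<mu> z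
  proof -
    have "\<mu> \<in> H" using p gen by (auto simp: generic_points_def)
    have "finite P" by (rule finite_subset[OF PR finite_roots])
    \<comment> \<open>The given coefficients are recovered by the dual functionals of the
      basis.\<close>
    have "uc i j (\<mu>, z) = Y i j (\<mu>, z)" if "i < d" "j < d" for i j
      using that uc[OF that(1) p] by (simp add: Y_def \<phi>_sum \<phi>_rules \<phi>(2) if_distrib sum.delta cong: if_cong)
    then have "Matrix.mat d d (\<lambda>(i, j). uc i j (\<mu>, z)) = Matrix.mat d d (\<lambda>(i, j). Y i j (\<mu>, z))"
      by (intro Matrix.eq_matI) auto
    moreover have "exp (l (\<mu>, z)) = exp (\<Sum>i\<in>UNIV. vec_nth z i / \<kappa> * trace_on st W (act i \<mu>))
        * (\<Prod>\<alpha>\<in>P. exp (\<delta> \<alpha> / \<kappa> * logroot \<alpha> (\<mu>, z)))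
        * (\<Prod>(i, j)\<in>{(i, j). i < j}. exp (\<epsilon> i j / \<kappa> * logdiff i j (\<mu>, z)))"
      by (simp add: l_def exp_add exp_sum \<open>finite P\<close> trace_act \<open>\<mu> \<in> H\<close> case_prod_beta)
    ultimately show ?thesis by (simp add: C(2)[OF p] mult.assoc)
  qed
  with C(1) show ?thesis by blast
qed

end
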